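(* Let $\Omega\subset\mathbb{R}^2$ be a bounded polygonal domain, $f\in[L^2(\Omega)]^2$, $\alpha\in\mathbb{R}$, $\mathcal{T}_h$ a conforming triangulation of $\Omega$, and $k$ a positive integer. The following are equivalent: (i) $(u_h,p_h,\hat u_h)\in V_h\times Q_h\times\hat V_h$ is a solution of the three-field problem: for all $(v_h,q_h,\hat v_h)\in V_h\times Q_h\times\hat V_h$, $$(\nabla\cdot u_h,\nabla\cdot v_h)_{\mathcal{T}_h}+(\nabla\times u_h,\nabla\times v_h)_{\mathcal{T}_h}+\alpha(u_h,v_h)_{\mathcal{T}_h}+\langle\hat p_h,v_h\rangle_{\partial\mathcal{T}_h}=(f,v_h)_{\mathcal{T}_h},$$ $$\langle u_h-\hat u_h,q_h\rangle_{\partial\mathcal{T}_h}=0,\qquad \langle\hat p_h,\hat v_h\rangle_{\partial\mathcal{T}_h}=0,$$ where $\hat p_h=p_h+\gamma(u_h-\hat u_h)$; (ii) $(u_h,p_h)\in V_h\times\mathring{Q}_h$ is a solution of the two-field problem: for all $(v_h,q_h)\in V_h\times\mathring{Q}_h$, $$a_h(u_h,v_h)+b_h(v_h,p_h)=(f,v_h)_{\mathcal{T}_h},\qquad b_h(u_h,q_h)=0;$$ and $\hat u_h\in\hat V_h$ is given by $\hat u_h=\{\!\!\{u_h\}\!\!\}$ on $\mathcal{E}_h^\circ$ and $\hat u_h\cdot n=u_h\cdot n$ on $\mathcal{E}_h^\partial$; (iii) $u_h\in\mathring{V}_h$ is a solution of the one-field problem $a_h(u_h,v_h)=(f,v_h)_{\mathcal{T}_h}$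 for all $v_h\in\mathring{V}_h$; $p_h\in\mathring{Q}_h$ satisfies $a_h(u_h,v_h)+b_h(v_h,p_h)=(f,v_h)_{\mathcal{T}_h}$ for all $v_h\in V_h$; and $\hat u_h\in\hat V_h$ is given by $\hat u_h=\{\!\!\{u_h\}\!\!\}$ on $\mathcal{E}_h^\circ$ and $\hat u_h\cdot n=u_h\cdot n$ on $\mathcal{E}_h^\partial$.
   Context: In two dimensions $\nabla\times v=\partial_1v_2-\partial_2v_1$ and $v\times n=v_1n_2-v_2n_1$. $\mathcal{E}_h$ is the set of edges of $\mathcal{T}_h$, partitioned into interior edges $\mathcal{E}_h^\circ$ and boundary edges $\mathcal{E}_h^\partial$; $n$ is the outer unit normal. Broken inner products: $(\cdot,\cdot)_{\mathcal{T}_h}=\sum_{K\in\mathcal{T}_h}(\cdot,\cdot)_K$, $\langle\cdot,\cdot\rangle_{\partial\mathcal{T}_h}=\sum_{K}\langle\cdot,\cdot\rangle_{\partial K}$, $\langle\cdot,\cdot\rangle_{\mathcal{E}_h^\circ}=\sum_{e\in\mathcal{E}_h^\circ}\langle\cdot,\cdot\rangle_e$, $\langle\cdot,\cdot\rangle_{\mathcal{E}_h^\partial}=\sum_{e\in\mathcal{E}_h^\partial}\langle\cdot,\cdot\rangle_e$ (all $L^2$; Frobenius product for matrices). With $P_j$ the polynomials of degree $\le j$, $$V_h=\prod_{K\in\mathcal{T}_h}[P_{2k-1}(K)]^2,\quad Q_h=\prod_{K\in\mathcal{T}_h}\prod_{e\subset\partial K}[P_{k-1}(e)]^2,\quad \hat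 V_h=\Bigl\{\hat v_h\in\prod_{e\in\mathcal{E}_h}[P_{2k-1}(e)]^2:\hat v_h\times n=0\text{ on }\mathcal{E}_h^\partial\Bigr\}.$$ Elements of $V_h,Q_h$ are generally double-valued on interior edges; elements of $\hat V_h$ are single-valued. For an interior edge $e$ shared by triangles $K^\pm$ with outward unit normals $n^\pm$, and $w$ with values $w^\pm$ from the two sides, $\{\!\!\{w\}\!\!\}_e=\frac12(w^++w^-)$ and $[\![w]\!]_e=w^+\otimes n^++w^-\otimes n^-$, where $w\otimes n=wn^\top$. Averages and jumps are not defined on boundary edges. Penalty: let $c_1,\dots,c_L$ be the corners of $\Omega$ with interior angles $\omega_\ell$, and choose $\mu_\ell=1$ if $\omega_\ell\le\pi/2$ and $\mu_\ell<\pi/(2\omega_\ell)$ if $\omega_\ell>\pi/2$. For an edge $e$ with midpoint $m_e$ and length $|e|$, $\Phi_\mu(e)=\prod_{\ell=1}^L|m_e-c_\ell|^{1-\mu_\ell}$, and $\gamma|_e=\gamma_e=[\Phi_\mu(e)]^2/|e|$. Further, $$\mathring{Q}_h=\{q_h\in Q_h:\{\!\!\{q_h\}\!\!\}=0\text{ on }\mathcal{E}_h^\circ,\ q_h\cdot n=0\text{ on }\mathcal{E}_h^\partial\},$$ $$a_h(u_h,v_h)=(\nabla\cdot u_h,\nabla\cdot v_h)_{\mathcal{T}_h}+(\nabla\times u_h,\nabla\times v_h)_{\mathcal{T}_h}+\alpha(u_h,v_h)_{\mathcal{T}_h}+\tfrac12\langle\gamma[\![u_h]\!],[\![v_h]\!]\rangle_{\mathcal{E}_h^\circ}+\langle\gamma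 u_h\times n,v_h\times n\rangle_{\mathcal{E}_h^\partial},$$ $$b_h(v_h,q_h)=\tfrac12\langle[\![v_h]\!],[\![q_h]\!]\rangle_{\mathcal{E}_h^\circ}+\langle v_h\times n,q_h\times n\rangle_{\mathcal{E}_h^\partial},$$ $$\mathring{V}_h=\{v_h\in V_h: b_h(v_h,q_h)=0\text{ for all }q_h\in\mathring{Q}_h\}.$$ *)

theory Defs
  imports "HOL-Analysis.Analysis"
begin

text \<open>
  A function that lives on the triangulation is a family of functions on the plane, indexed by
  triangles (\<open>v K\<close>), by edges (\<open>w e\<close>), or by pairs of a triangle and one of its edges (\<open>q K e\<close>).
  Only the values of \<open>v K\<close> on \<open>K\<close>, and of \<open>w e\<close> and \<open>q K e\<close> on \<open>e\<close>, are ever constrained or used.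
\<close>

type_synonym point = "real^2"
type_synonym broken_field = "point set \<Rightarrow> point \<Rightarrow> real^2"
type_synonym skeleton_field = "point set \<Rightarrow> point \<Rightarrow> real^2"
type_synonym 'a trace = "point set \<Rightarrow> point set \<Rightarrow> point \<Rightarrow> 'a"


subsection \<open>Polygonal domains, corners, triangulations\<close>

definition has_interior_angle :: "point set \<Rightarrow> point \<Rightarrow> real \<Rightarrow> bool" where
  "has_interior_angle \<Omega> c \<omega> \<longleftrightarrow> 0 < \<omega> \<and> \<omega> < 2 * pi \<and>
     (\<exists>r>0. \<exists>\<theta>. \<Omega> \<inter> ball c r =
        {c + \<rho> *\<^sub>R vector [cos \<phi>, sin \<phi>] | \<rho> \<phi>. 0 < \<rho> \<and> \<rho> < r \<and> \<theta> < \<phi> \<and> \<phi> < \<theta> + \<omega>})"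

text \<open>
  The last condition says that the domain lies locally on one side of its boundary: it excludes
  cracks and points at which the boundary touches itself. Holes are allowed.
\<close>

definition polygonal_domain :: "point set \<Rightarrow> bool" where
  "polygonal_domain \<Omega> \<longleftrightarrow> open \<Omega> \<and> connected \<Omega> \<and> \<Omega> \<noteq> {} \<and>
     (\<exists>S. finite S \<and> (\<forall>s\<in>S. \<exists>a b. s = closed_segment a b) \<and> frontier \<Omega> = \<Union>S) \<and>
     (\<forall>x\<in>frontier \<Omega>. \<exists>\<omega>. has_interior_angle \<Omega> x \<omega>)"

definition corners :: "point set \<Rightarrow> point set" where
  "corners \<Omega> = {c \<in> frontier \<Omega>. \<exists>\<omega>. has_interior_angle \<Omega> c \<omega> \<and> \<omega> \<noteq> pi}"

text \<open>The predicate \<^const>\<open>triangulation\<close> already demands that any two members meet in a common face.\<close>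

definition conforming_triangulation :: "point set \<Rightarrow> point set set \<Rightarrow> bool" where
  "conforming_triangulation \<Omega> T \<longleftrightarrow>
     triangulation T \<and> (\<forall>K\<in>T. 2 simplex K) \<and> \<Union>T = closure \<Omega>"

definition edges :: "point set set \<Rightarrow> point set set" where
  "edges T = {e. \<exists>K\<in>T. e edge_of K}"

definition bd_edges :: "point set \<Rightarrow> point set set \<Rightarrow> point set set" where
  "bd_edges \<Omega> T = {e \<in> edges T. e \<subseteq> frontier \<Omega>}"

definition int_edges :: "point set \<Rightarrow> point set set \<Rightarrow> point set set" where
  "int_edges \<Omega> T = edges T - bd_edges \<Omega> T"

definition triangles_at :: "point set set \<Rightarrow> point set \<Rightarrow> point set set" where
  "triangles_at T e = {K \<in> T. e edge_of K}"

definition bd_triangle :: "point set set \<Rightarrow> point set \<Rightarrow> point set" where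
  "bd_triangle T e = (THE K. K \<in> T \<and> e edge_of K)"

definition outer_normal :: "point set \<Rightarrow> point set \<Rightarrow> real^2" where
  "outer_normal K e = (THE n. norm n = 1 \<and> (\<forall>x\<in>K. \<forall>y\<in>e. n \<bullet> (x - y) \<le> 0))"

text \<open>The order of the two end points is arbitrary; nothing below depends on it.\<close>

definition edge_ends :: "point set \<Rightarrow> point \<times> point" where
  "edge_ends e = (SOME (a, b). e = closed_segment a b)"

definition edge_length :: "point set \<Rightarrow> real" where
  "edge_length e = dist (fst (edge_ends e)) (snd (edge_ends e))"

definition edge_midpoint :: "point set \<Rightarrow> point" where
  "edge_midpoint e = midpoint (fst (edge_ends e)) (snd (edge_ends e))"


subsection \<open>Vector operations, averages and jumps\<close>

definition cross :: "real^2 \<Rightarrow> real^2 \<Rightarrow> real" where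
  "cross v n = v $ 1 * n $ 2 - v $ 2 * n $ 1"

definition tensor :: "real^2 \<Rightarrow> real^2 \<Rightarrow> real^2^2" where
  "tensor w n = (\<chi> i j. w $ i * n $ j)"

text \<open>
  Derivatives are taken within the triangle, so that they do not depend on the values of the
  field outside it.
\<close>

definition partial_within :: "point set \<Rightarrow> 2 \<Rightarrow> (point \<Rightarrow> real^2) \<Rightarrow> point \<Rightarrow> real^2" where
  "partial_within K i v x = frechet_derivative v (at x within K) (axis i 1)"

definition divergence :: "point set \<Rightarrow> (point \<Rightarrow> real^2) \<Rightarrow> point \<Rightarrow> real" where
  "divergence K v x = partial_within K 1 v x $ 1 + partial_within K 2 v x $ 2"

definition curl :: "point set \<Rightarrow> (point \<Rightarrow> real^2) \<Rightarrow> point \<Rightarrow> real" where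
  "curl K v x = partial_within K 1 v x $ 2 - partial_within K 2 v x $ 1"

definition trace_of :: "broken_field \<Rightarrow> (real^2) trace" where
  "trace_of v K e = v K"

text \<open>
  Average and jump are used on interior edges only. There the sums have exactly two terms, one
  for each of the two triangles sharing the edge.
\<close>

definition average :: "point set set \<Rightarrow> (real^2) trace \<Rightarrow> point set \<Rightarrow> point \<Rightarrow> real^2" where
  "average T w e x = (1/2) *\<^sub>R (\<Sum>K\<in>triangles_at T e. w K e x)"

definition jump :: "point set set \<Rightarrow> (real^2) trace \<Rightarrow> point set \<Rightarrow> point \<Rightarrow> real^2^2" where
  "jump T w e x = (\<Sum>K\<in>triangles_at T e. tensor (w K e x) (outer_normal K e))"

definition bd_value :: "point set set \<Rightarrow> (real^2) trace \<Rightarrow> point set \<Rightarrow> point \<Rightarrow> real^2" where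
  "bd_value T w e x = w (bd_triangle T e) e x"

definition bd_normal :: "point set set \<Rightarrow> point set \<Rightarrow> real^2" where
  "bd_normal T e = outer_normal (bd_triangle T e) e"

definition bd_tangential :: "point set set \<Rightarrow> (real^2) trace \<Rightarrow> point set \<Rightarrow> point \<Rightarrow> real" where
  "bd_tangential T w e x = cross (bd_value T w e x) (bd_normal T e)"


subsection \<open>Inner products\<close>

definition L2_on :: "point set \<Rightarrow> (point \<Rightarrow> real^2) \<Rightarrow> bool" where
  "L2_on A f \<longleftrightarrow> set_borel_measurable lebesgue A f \<and>
     set_integrable lebesgue A (\<lambda>x. (norm (f x))\<^sup>2)"

definition ip_on :: "point set \<Rightarrow> (point \<Rightarrow> 'a::real_inner) \<Rightarrow> (point \<Rightarrow> 'a) \<Rightarrow> real" where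
  "ip_on K g h = (LINT x:K|lebesgue. g x \<bullet> h x)"

text \<open>The integral with respect to arc length, in the affine parametrization of the edge. For
  matrices, \<open>\<bullet>\<close> is the Frobenius product.\<close>

definition ip_edge :: "point set \<Rightarrow> (point \<Rightarrow> 'a::real_inner) \<Rightarrow> (point \<Rightarrow> 'a) \<Rightarrow> real" where
  "ip_edge e g h = (case edge_ends e of (a, b) \<Rightarrow>
     dist a b * (LINT t:{0..1}|lborel.
       g ((1 - t) *\<^sub>R a + t *\<^sub>R b) \<bullet> h ((1 - t) *\<^sub>R a + t *\<^sub>R b)))"

definition ip_broken ::
  "point set set \<Rightarrow> (point set \<Rightarrow> point \<Rightarrow> 'a::real_inner) \<Rightarrow> (point set \<Rightarrow> point \<Rightarrow> 'a) \<Rightarrow> real" where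
  "ip_broken T g h = (\<Sum>K\<in>T. ip_on K (g K) (h K))"

definition ip_boundaries :: "point set set \<Rightarrow> 'a::real_inner trace \<Rightarrow> 'a trace \<Rightarrow> real" where
  "ip_boundaries T g h = (\<Sum>K\<in>T. \<Sum>e | e edge_of K. ip_edge e (g K e) (h K e))"

definition ip_edges ::
  "point set set \<Rightarrow> (point set \<Rightarrow> point \<Rightarrow> 'a::real_inner) \<Rightarrow> (point set \<Rightarrow> point \<Rightarrow> 'a) \<Rightarrow> real" where
  "ip_edges E g h = (\<Sum>e\<in>E. ip_edge e (g e) (h e))"


subsection \<open>Finite element spaces\<close>

text \<open>
  Restrictions to \<open>S\<close> of the polynomials of total degree at most \<open>j\<close> in the two coordinates. If
  \<open>S\<close> is a segment, these are the polynomials of degree at most \<open>j\<close> in the arc length.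
\<close>

definition Poly :: "nat \<Rightarrow> point set \<Rightarrow> (point \<Rightarrow> real) set" where
  "Poly j S = {g. \<exists>c :: nat \<Rightarrow> nat \<Rightarrow> real. \<forall>x\<in>S.
     g x = (\<Sum>a\<le>j. \<Sum>b\<le>j - a. c a b * (x $ 1) ^ a * (x $ 2) ^ b)}"

definition Poly2 :: "nat \<Rightarrow> point set \<Rightarrow> (point \<Rightarrow> real^2) set" where
  "Poly2 j S = {g. \<forall>i. (\<lambda>x. g x $ i) \<in> Poly j S}"

definition Vh :: "point set set \<Rightarrow> nat \<Rightarrow> broken_field set" where
  "Vh T k = (\<Pi> K\<in>T. Poly2 (2 * k - 1) K)"

definition Qh :: "point set set \<Rightarrow> nat \<Rightarrow> (real^2) trace set" where
  "Qh T k = (\<Pi> K\<in>T. \<Pi> e\<in>{e. e edge_of K}. Poly2 (k - 1) e)"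

definition Vhat :: "point set \<Rightarrow> point set set \<Rightarrow> nat \<Rightarrow> skeleton_field set" where
  "Vhat \<Omega> T k = {v \<in> (\<Pi> e\<in>edges T. Poly2 (2 * k - 1) e).
     \<forall>e\<in>bd_edges \<Omega> T. \<forall>x\<in>e. cross (v e x) (bd_normal T e) = 0}"

definition Qh0 :: "point set \<Rightarrow> point set set \<Rightarrow> nat \<Rightarrow> (real^2) trace set" where
  "Qh0 \<Omega> T k = {q \<in> Qh T k.
     (\<forall>e\<in>int_edges \<Omega> T. \<forall>x\<in>e. average T q e x = 0) \<and>
     (\<forall>e\<in>bd_edges \<Omega> T. \<forall>x\<in>e. bd_value T q e x \<bullet> bd_normal T e = 0)}"


subsection \<open>Penalty weights\<close>

definition grading :: "point set \<Rightarrow> (point \<Rightarrow> real) \<Rightarrow> bool" where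
  "grading \<Omega> \<mu> \<longleftrightarrow> (\<forall>c\<in>corners \<Omega>. \<forall>\<omega>. has_interior_angle \<Omega> c \<omega> \<longrightarrow>
     (\<omega> \<le> pi / 2 \<longrightarrow> \<mu> c = 1) \<and> (\<omega> > pi / 2 \<longrightarrow> \<mu> c < pi / (2 * \<omega>)))"

definition Phi :: "point set \<Rightarrow> (point \<Rightarrow> real) \<Rightarrow> point set \<Rightarrow> real" where
  "Phi \<Omega> \<mu> e = (\<Prod>c\<in>corners \<Omega>. norm (edge_midpoint e - c) powr (1 - \<mu> c))"

definition penalty :: "point set \<Rightarrow> (point \<Rightarrow> real) \<Rightarrow> point set \<Rightarrow> real" where
  "penalty \<Omega> \<mu> e = (Phi \<Omega> \<mu> e)\<^sup>2 / edge_length e"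


subsection \<open>Bilinear forms and discrete problems\<close>

definition vol_form :: "point set set \<Rightarrow> real \<Rightarrow> broken_field \<Rightarrow> broken_field \<Rightarrow> real" where
  "vol_form T \<alpha> u v =
     ip_broken T (\<lambda>K. divergence K (u K)) (\<lambda>K. divergence K (v K))
   + ip_broken T (\<lambda>K. curl K (u K)) (\<lambda>K. curl K (v K))
   + \<alpha> * ip_broken T u v"

definition load :: "point set set \<Rightarrow> (point \<Rightarrow> real^2) \<Rightarrow> broken_field \<Rightarrow> real" where
  "load T f v = ip_broken T (\<lambda>K. f) v"

definition ah :: "point set \<Rightarrow> point set set \<Rightarrow> (point \<Rightarrow> real) \<Rightarrow> real
    \<Rightarrow> broken_field \<Rightarrow> broken_field \<Rightarrow> real" where
  "ah \<Omega> T \<mu> \<alpha> u v = vol_form T \<alpha> u v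
   + (1/2) * ip_edges (int_edges \<Omega> T)
       (\<lambda>e x. penalty \<Omega> \<mu> e *\<^sub>R jump T (trace_of u) e x) (jump T (trace_of v))
   + ip_edges (bd_edges \<Omega> T)
       (\<lambda>e x. penalty \<Omega> \<mu> e * bd_tangential T (trace_of u) e x) (bd_tangential T (trace_of v))"

definition bh :: "point set \<Rightarrow> point set set \<Rightarrow> broken_field \<Rightarrow> (real^2) trace \<Rightarrow> real" where
  "bh \<Omega> T v q =
     (1/2) * ip_edges (int_edges \<Omega> T) (jump T (trace_of v)) (jump T q)
   + ip_edges (bd_edges \<Omega> T) (bd_tangential T (trace_of v)) (bd_tangential T q)"

definition Vh0 :: "point set \<Rightarrow> point set set \<Rightarrow> nat \<Rightarrow> broken_field set" where
  "Vh0 \<Omega> T k = {v \<in> Vh T k. \<forall>q\<in>Qh0 \<Omega> T k. bh \<Omega> T v q = 0}"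

definition numerical_flux :: "point set \<Rightarrow> (point \<Rightarrow> real) \<Rightarrow> broken_field \<Rightarrow> (real^2) trace
    \<Rightarrow> skeleton_field \<Rightarrow> (real^2) trace" where
  "numerical_flux \<Omega> \<mu> u p uhat K e x = p K e x + penalty \<Omega> \<mu> e *\<^sub>R (u K x - uhat e x)"

definition three_field_solution :: "point set \<Rightarrow> point set set \<Rightarrow> nat \<Rightarrow> (point \<Rightarrow> real) \<Rightarrow> real
    \<Rightarrow> (point \<Rightarrow> real^2) \<Rightarrow> broken_field \<Rightarrow> (real^2) trace \<Rightarrow> skeleton_field \<Rightarrow> bool" where
  "three_field_solution \<Omega> T k \<mu> \<alpha> f u p uhat \<longleftrightarrow>
     u \<in> Vh T k \<and> p \<in> Qh T k \<and> uhat \<in> Vhat \<Omega> T k \<and>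
     (\<forall>v\<in>Vh T k. \<forall>q\<in>Qh T k. \<forall>vhat\<in>Vhat \<Omega> T k.
        vol_form T \<alpha> u v + ip_boundaries T (numerical_flux \<Omega> \<mu> u p uhat) (trace_of v) = load T f v \<and>
        ip_boundaries T (\<lambda>K e x. u K x - uhat e x) q = 0 \<and>
        ip_boundaries T (numerical_flux \<Omega> \<mu> u p uhat) (\<lambda>K e. vhat e) = 0)"

definition two_field_solution :: "point set \<Rightarrow> point set set \<Rightarrow> nat \<Rightarrow> (point \<Rightarrow> real) \<Rightarrow> real
    \<Rightarrow> (point \<Rightarrow> real^2) \<Rightarrow> broken_field \<Rightarrow> (real^2) trace \<Rightarrow> bool" where
  "two_field_solution \<Omega> T k \<mu> \<alpha> f u p \<longleftrightarrow>
     u \<in> Vh T k \<and> p \<in> Qh0 \<Omega> T k \<and>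
     (\<forall>v\<in>Vh T k. \<forall>q\<in>Qh0 \<Omega> T k.
        ah \<Omega> T \<mu> \<alpha> u v + bh \<Omega> T v p = load T f v \<and> bh \<Omega> T u q = 0)"

definition one_field_solution :: "point set \<Rightarrow> point set set \<Rightarrow> nat \<Rightarrow> (point \<Rightarrow> real) \<Rightarrow> real
    \<Rightarrow> (point \<Rightarrow> real^2) \<Rightarrow> broken_field \<Rightarrow> bool" where
  "one_field_solution \<Omega> T k \<mu> \<alpha> f u \<longleftrightarrow>
     u \<in> Vh0 \<Omega> T k \<and> (\<forall>v\<in>Vh0 \<Omega> T k. ah \<Omega> T \<mu> \<alpha> u v = load T f v)"

definition multiplier_for :: "point set \<Rightarrow> point set set \<Rightarrow> nat \<Rightarrow> (point \<Rightarrow> real) \<Rightarrow> real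
    \<Rightarrow> (point \<Rightarrow> real^2) \<Rightarrow> broken_field \<Rightarrow> (real^2) trace \<Rightarrow> bool" where
  "multiplier_for \<Omega> T k \<mu> \<alpha> f u p \<longleftrightarrow>
     p \<in> Qh0 \<Omega> T k \<and> (\<forall>v\<in>Vh T k. ah \<Omega> T \<mu> \<alpha> u v + bh \<Omega> T v p = load T f v)"

definition skeleton_values_of :: "point set \<Rightarrow> point set set \<Rightarrow> nat
    \<Rightarrow> broken_field \<Rightarrow> skeleton_field \<Rightarrow> bool" where
  "skeleton_values_of \<Omega> T k u uhat \<longleftrightarrow>
     uhat \<in> Vhat \<Omega> T k \<and>
     (\<forall>e\<in>int_edges \<Omega> T. \<forall>x\<in>e. uhat e x = average T (trace_of u) e x) \<and>
     (\<forall>e\<in>bd_edges \<Omega> T. \<forall>x\<in>e.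
        uhat e x \<bullet> bd_normal T e = bd_value T (trace_of u) e x \<bullet> bd_normal T e)"

end

theory Submission
  imports Defs
begin

text \<open>
  An interior edge has exactly two triangles, with opposite normals, and a boundary edge exactly
  one. Grouping the boundary integrals by edges and splitting vectors into average and jump (normal
  and tangential part on the boundary), the boundary pairing of a trace with a mean-free one only
  sees jumps. Since \<open>u - uhat\<close> is mean-free once \<open>uhat\<close> has the prescribed skeleton values, this
  turns the fluxes into the jump terms of the two-field problem. Conversely, test functions
  supported on one edge show that \<open>{p} + \<gamma> ({u} - uhat)\<close> vanishes and that \<open>{u} - uhat\<close> is
  orthogonal to \<open>{p}\<close>, so \<open>{p} = 0\<close>, and \<open>uhat = {u}\<close> because \<open>\<gamma> \<noteq> 0\<close>; likewise for normal
  components on the boundary. That \<open>\<gamma>\<close> is nonzero needs the midpoint of an edge not to be a corner: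
  there the closure of the domain is locally a half plane or a full disc.
\<close>

subsection \<open>Triangles and their outer normals\<close>

text \<open>The mesh is known only as a triangulation with union \<open>closure \<Omega>\<close>,
  and edges are sorted by inclusion in the frontier, so counting the triangles at an edge is a
  matter of plane topology. It rests on one local picture: near a point inside an edge, the closure
  of the domain is the union of the half planes cut out by the triangles at that edge. Triangles
  with equal normals overlap and hence coincide, so this union is a half plane or everything.
  Interior angles below 2 pi exclude a full neighbourhood at frontier points.

  The two tests on an edge must be combined because of the degrees: {u} - uhat has degree 2k - 1 and
  cannot be tested with itself in the second equation, whose test functions have degree k - 1. But
  {p} is admissible there, and the flux average may be tested with itself in the third equation,
  whose test functions have degree 2k - 1.\<close>

lemma orthogonal_complement_plane:
  fixes n d y :: "real^2"
  assumes "n \<noteq> 0" "d \<noteq> 0" "n \<bullet> d = 0" "n \<bullet> y = 0"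
  shows "y = ((y \<bullet> d) / (d \<bullet> d)) *\<^sub>R d"
proof -
  have nd: "n$1 * d$1 + n$2 * d$2 = 0" and ny: "n$1 * y$1 + n$2 * y$2 = 0"
    using assms by (simp_all add: inner_vec_def sum_2)
  \<comment> \<open>The determinant of \<open>y\<close> and \<open>d\<close> is annihilated by both
    coordinates of \<open>n\<close>, one of which is nonzero; so \<open>y\<close> and
    \<open>d\<close> are parallel.\<close>
  have "n$1 * (y$1 * d$2 - y$2 * d$1) = 0" "n$2 * (y$1 * d$2 - y$2 * d$1) = 0"
    using nd ny by algebra+
  moreover have "n$1 \<noteq> 0 \<or> n$2 \<noteq> 0"
    using assms(1) by (auto simp: vec_eq_iff forall_2)
  ultimately have c: "y$1 * d$2 = y$2 * d$1" by auto
  have "y$1 * (d \<bullet> d) = (y \<bullet> d) * d$1" "y$2 * (d \<bullet> d) = (y \<bullet> d) * d$2"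
    using c by (simp_all add: inner_vec_def sum_2, algebra+)
  moreover have "d \<bullet> d \<noteq> 0" using assms by simp
  ultimately show ?thesis
    by (simp add: vec_eq_iff forall_2 field_simps)
qed

text \<open>Faces of a simplex are hulls of subsets of its vertices, and dimension one selects two
  of them. A segment determines its end points as a set, so these two vertices are \<open>a\<close>
  and \<open>b\<close> for whatever description of the edge is given.\<close>

lemma edge_of_triangle:
  fixes K :: "'a::euclidean_space set"
  assumes "2 simplex K" "closed_segment a b edge_of K"
  obtains c where "K = convex hull {a, b, c}" "\<not> collinear {a, b, c}"
proof -
  obtain C where C: "\<not> affine_dependent C" "int (card C) = 2 + 1" "K = convex hull C"
    using assms(1) by (auto simp: simplex_def)
  have "closed_segment a b face_of convex hull C" and ad: "aff_dim (closed_segment a b) = 1"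
    using assms(2) C by (auto simp: edge_of_def)
  then obtain D where D: "D \<subseteq> C" "closed_segment a b = convex hull D"
    using face_of_convex_hull_affine_independent[OF C(1)] by blast
  have "\<not> affine_dependent D" using C(1) D(1) affine_dependent_subset by blast
  then have "card D = 2"
    using ad D(2) by (metis aff_dim_convex_hull aff_dim_affine_independent of_nat_eq_iff
        one_add_one of_nat_numeral)
  then obtain p q where pq: "D = {p, q}" "p \<noteq> q" by (auto simp: card_2_iff)
  then have "closed_segment a b = closed_segment p q"
    using D(2) by (simp add: segment_convex_hull)
  then have ab: "D = {a, b}" "a \<noteq> b" using pq by (auto simp: doubleton_eq_iff)
  have "finite C" using C(1) aff_independent_finite by blast
  then have "card (C - D) = 1"
    using C(2) D(1) \<open>card D = 2\<close> by (simp add: card_Diff_subset finite_subset)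
  then obtain c where c: "C - D = {c}" by (auto simp: card_1_singleton_iff)
  then have Cabc: "C = {a, b, c}" using D(1) ab by auto
  have "c \<noteq> a" "c \<noteq> b" using c ab by auto
  then have "\<not> collinear {a, b, c}"
    using C(1) ab Cabc by (auto simp: collinear_3_eq_affine_dependent)
  with that Cabc C(3) show ?thesis by blast
qed

lemma normal_to_segment:
  fixes a b c :: "real^2"
  assumes "\<not> collinear {a, b, c}"
  obtains n where "norm n = 1" "n \<bullet> (b - a) = 0" "n \<bullet> (c - a) < 0"
proof -
  have ab: "b - a \<noteq> 0" using assms by auto
  \<comment> \<open>A quarter turn of \<open>b - a\<close>.\<close>
  define r :: "real^2" where "r = vector [(b - a)$2, - (b - a)$1]"
  have r: "r \<bullet> (b - a) = 0" by (simp add: r_def inner_vec_def sum_2 vector_2 algebra_simps)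
  have r0: "r \<noteq> 0" using ab by (auto simp: r_def vec_eq_iff forall_2 vector_2)
  have "r \<bullet> (c - a) \<noteq> 0"
  proof
    assume "r \<bullet> (c - a) = 0"
    then obtain s where "c - a = s *\<^sub>R (b - a)"
      using orthogonal_complement_plane[OF r0 ab r] by blast
    then have "c = s *\<^sub>R b + (1 - s) *\<^sub>R a" by (simp add: algebra_simps)
    then have "collinear {b, c, a}" by (auto simp: collinear_3_expand)
    with assms show False by (simp add: insert_commute)
  qed
  \<comment> \<open>The factor normalises \<open>r\<close> and turns it away from
    \<open>c\<close>.\<close>
  define s where "s = - sgn (r \<bullet> (c - a)) / norm r"
  have "norm (s *\<^sub>R r) = 1"
    using r0 \<open>r \<bullet> (c - a) \<noteq> 0\<close> by (simp add: s_def abs_sgn_eq)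
  moreover have "s *\<^sub>R r \<bullet> (b - a) = 0" using r by simp
  moreover have "s *\<^sub>R r \<bullet> (c - a) < 0"
    using r0 \<open>r \<bullet> (c - a) \<noteq> 0\<close> by (auto simp: s_def sgn_real_def field_simps)
  ultimately show ?thesis using that by blast
qed

text \<open>Since \<open>outer_normal\<close> is a definite description, existence and uniqueness
  come first. For uniqueness, comparing \<open>a\<close> with \<open>b\<close> both ways makes a
  candidate orthogonal to \<open>b - a\<close>, hence plus or minus the known normal, and the vertex
  \<open>c\<close> decides the sign.\<close>

lemma outer_normal_triangle:
  assumes K: "K = convex hull {a, b, c}" and nc: "\<not> collinear {a, b, c}"
  defines "n \<equiv> outer_normal K (closed_segment a b)"
  shows "norm n = 1" "n \<bullet> (b - a) = 0" "n \<bullet> (c - a) < 0"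
proof -
  obtain n0 where n0: "norm n0 = 1" "n0 \<bullet> (b - a) = 0" "n0 \<bullet> (c - a) < 0"
    using normal_to_segment[OF nc] .
  have ab: "b - a \<noteq> 0" using nc by auto
  have in_K: "a \<in> K" "b \<in> K" "c \<in> K" by (auto simp: K hull_inc)
  have le: "n0 \<bullet> (x - a) \<le> 0" if "x \<in> K" for x
  proof -
    obtain u v w where "x = u *\<^sub>R a + v *\<^sub>R b + w *\<^sub>R c" and w: "0 \<le> w" "u + v + w = 1"
      using \<open>x \<in> K\<close> by (auto simp: K convex_hull_3)
    moreover have "u = 1 - v - w" using w by simp
    ultimately have "x - a = v *\<^sub>R (b - a) + w *\<^sub>R (c - a)" by (simp add: algebra_simps)
    then show ?thesis using n0 w by (simp add: inner_add_right mult_nonneg_nonpos)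
  qed
  have eq: "n0 \<bullet> (y - a) = 0" if y: "y \<in> closed_segment a b" for y
  proof -
    obtain t where "y = (1 - t) *\<^sub>R a + t *\<^sub>R b"
      using y unfolding in_segment by blast
    then have "y - a = t *\<^sub>R (b - a)" by (simp add: algebra_simps)
    then show ?thesis using n0 by simp
  qed
  have "n = n0"
    unfolding n_def outer_normal_def
  proof (rule the_equality)
    show "norm n0 = 1 \<and> (\<forall>x\<in>K. \<forall>y\<in>closed_segment a b. n0 \<bullet> (x - y) \<le> 0)"
    proof (intro conjI ballI)
      fix x y assume "x \<in> K" "y \<in> closed_segment a b"
      then show "n0 \<bullet> (x - y) \<le> 0" using le[of x] eq[of y] by (simp add: inner_diff_right)
    qed (fact n0)
  next
    fix m assume m: "norm m = 1 \<and> (\<forall>x\<in>K. \<forall>y\<in>closed_segment a b. m \<bullet> (x - y) \<le> 0)"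
    then have "m \<bullet> (b - a) \<le> 0" "m \<bullet> (a - b) \<le> 0" and mc: "m \<bullet> (c - a) \<le> 0"
      using in_K by simp_all
    then have m0: "m \<bullet> (b - a) = 0" by (simp add: inner_diff_right)
    define s where "s = (m \<bullet> n0) / (n0 \<bullet> n0)"
    have ms: "m = s *\<^sub>R n0"
      unfolding s_def using n0 m0
      by (intro orthogonal_complement_plane[OF ab]) (auto simp: inner_commute)
    then have "\<bar>s\<bar> = 1" using m n0 by simp
    moreover have "s \<ge> 0" using ms mc n0 by (simp add: mult_le_0_iff)
    ultimately show "m = n0" using ms by simp
  qed
  with n0 show "norm n = 1" "n \<bullet> (b - a) = 0" "n \<bullet> (c - a) < 0" by auto
qed

text \<open>Membership in the triangle means nonnegative barycentric coordinates. At a point inside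
  the edge those of \<open>a\<close> and \<open>b\<close> are positive and stay so nearby; only the
  sign of the coordinate of \<open>c\<close> is left, and this is the sign of the linear form given
  by the normal, reversed.\<close>

lemma triangle_near_edge:
  assumes K: "2 simplex K" and e: "closed_segment a b edge_of K" and m: "m \<in> open_segment a b"
  shows "\<forall>\<^sub>F x in nhds m. x \<in> K \<longleftrightarrow> outer_normal K (closed_segment a b) \<bullet> (x - m) \<le> 0"
proof -
  define n where "n = outer_normal K (closed_segment a b)"
  obtain c where Kc: "K = convex hull {a, b, c}" and nc: "\<not> collinear {a, b, c}"
    using edge_of_triangle[OF K e] .
  have n: "norm n = 1" "n \<bullet> (b - a) = 0" "n \<bullet> (c - a) < 0"
    unfolding n_def using outer_normal_triangle[OF Kc nc] by auto
  have ab: "b - a \<noteq> 0" using nc by auto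
  have n0: "n \<noteq> 0" using n by auto
  obtain t where t: "0 < t" "t < 1" "m = (1 - t) *\<^sub>R a + t *\<^sub>R b"
    using m by (auto simp: in_segment)
  then have ma: "m - a = t *\<^sub>R (b - a)" by (simp add: algebra_simps)
  have nm: "n \<bullet> (x - a) = n \<bullet> (x - m)" for x
  proof -
    have "x - a = (x - m) + t *\<^sub>R (b - a)" using ma by (metis diff_add_cancel add_diff_eq)
    then have "n \<bullet> (x - a) = n \<bullet> (x - m) + t * (n \<bullet> (b - a))"
      by (metis inner_add_right inner_scaleR_right)
    then show ?thesis using n by simp
  qed
  \<comment> \<open>\<open>w\<close> and \<open>v\<close> are the barycentric coordinates at
    \<open>c\<close> and \<open>b\<close>: pairing with \<open>n\<close> kills \<open>b - a\<close>
    and yields \<open>w\<close>, and projecting the remainder onto \<open>b - a\<close> yields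
    \<open>v\<close>.\<close>
  define w where "w = (\<lambda>x. (n \<bullet> (x - a)) / (n \<bullet> (c - a)))"
  define v where "v = (\<lambda>x. ((x - a - w x *\<^sub>R (c - a)) \<bullet> (b - a)) / ((b - a) \<bullet> (b - a)))"
  have rep: "x - a = v x *\<^sub>R (b - a) + w x *\<^sub>R (c - a)" for x
  proof -
    have "n \<bullet> (x - a - w x *\<^sub>R (c - a)) = 0"
      using n(3) by (simp add: inner_diff_right[of _ "x - a"] w_def)
    from orthogonal_complement_plane[OF n0 ab n(2) this]
    show ?thesis unfolding v_def by (metis diff_add_cancel)
  qed
  have "w m = 0" using n by (simp add: w_def ma)
  then have vm: "v m = t" using ab by (simp add: v_def ma)
  have wc: "(w \<longlongrightarrow> 0) (nhds m)" and vc: "(v \<longlongrightarrow> t) (nhds m)"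
  proof -
    have 1: "(w \<longlongrightarrow> w m) (nhds m)" unfolding w_def using n(3)
      by (intro tendsto_intros) (auto simp: filterlim_ident)
    moreover have "(v \<longlongrightarrow> v m) (nhds m)" unfolding v_def using ab
      by (intro tendsto_intros 1) (auto simp: filterlim_ident)
    ultimately show "(w \<longlongrightarrow> 0) (nhds m)" "(v \<longlongrightarrow> t) (nhds m)"
      using \<open>w m = 0\<close> vm by auto
  qed
  have "((\<lambda>x. v x + w x) \<longlongrightarrow> t + 0) (nhds m)" by (intro tendsto_intros wc vc)
  then have "\<forall>\<^sub>F x in nhds m. v x + w x < 1" using t by (auto dest: order_tendstoD(2))
  moreover have "\<forall>\<^sub>F x in nhds m. 0 < v x" using vc t by (auto dest: order_tendstoD(1))
  ultimately have "\<forall>\<^sub>F x in nhds m. x \<in> K \<longleftrightarrow> n \<bullet> (x - m) \<le> 0"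
  proof eventually_elim
    case (elim x)
    show ?case
    proof
      assume "n \<bullet> (x - m) \<le> 0"
      then have "w x \<ge> 0" using n(3) by (simp add: w_def nm divide_nonpos_neg)
      moreover have "x = (1 - v x - w x) *\<^sub>R a + v x *\<^sub>R b + w x *\<^sub>R c"
        using rep[of x] by (simp add: algebra_simps)
      ultimately show "x \<in> K"
        unfolding Kc convex_hull_3 using elim
        by (intro CollectI exI[of _ "1 - v x - w x"] exI[of _ "v x"] exI[of _ "w x"]) auto
    next
      assume "x \<in> K"
      then obtain p q r where "x = p *\<^sub>R a + q *\<^sub>R b + r *\<^sub>R c" and r: "0 \<le> r" "p + q + r = 1"
        by (auto simp: Kc convex_hull_3)
      moreover have "p = 1 - q - r" using r by simp
      ultimately have "x - a = q *\<^sub>R (b - a) + r *\<^sub>R (c - a)" by (simp add: algebra_simps)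
      then have "n \<bullet> (x - a) \<le> 0" using n r by (simp add: inner_add_right mult_nonneg_nonpos)
      then show "n \<bullet> (x - m) \<le> 0" by (simp add: nm)
    qed
  qed
  then show ?thesis by (simp add: n_def)
qed

text \<open>Lets a statement about a neighbourhood be tested in one well-chosen direction.\<close>

lemma eventually_nhds_ray:
  fixes c v :: "'a::real_normed_vector"
  assumes "\<forall>\<^sub>F y in nhds c. P y"
  shows "\<forall>\<^sub>F s in at_right 0. P (c + s *\<^sub>R v)"
proof -
  have "((\<lambda>s. c + s *\<^sub>R v) \<longlongrightarrow> c + 0 *\<^sub>R v) (at_right 0)"
    by (intro tendsto_intros)
  then show ?thesis
    using assms eventually_compose_filterlim by fastforce
qed

subsection \<open>Interior angles\<close>

text \<open>With \<open>b\<close> the direction of the bisector, every direction of the sector makes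
  an angle of at most \<omega>/2 with \<open>b\<close>, and the cosine decreases on [0, pi]. The
  resulting cone is closed, so it also contains the closure near \<open>c\<close>. In this form it
  covers non-convex sectors too.\<close>

lemma closure_in_cone:
  assumes "has_interior_angle \<Omega> c \<omega>"
  obtains b where "norm b = 1"
    and "\<forall>\<^sub>F y in nhds c. y \<in> closure \<Omega> \<longrightarrow> cos (\<omega> / 2) * norm (y - c) \<le> b \<bullet> (y - c)"
proof -
  obtain r \<theta> where om: "0 < \<omega>" "\<omega> < 2 * pi" and r: "r > 0"
    and S: "\<Omega> \<inter> ball c r = {c + \<rho> *\<^sub>R vector [cos \<phi>, sin \<phi>] | \<rho> \<phi>.
              0 < \<rho> \<and> \<rho> < r \<and> \<theta> < \<phi> \<and> \<phi> < \<theta> + \<omega>}"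
    using assms by (auto simp: has_interior_angle_def)
  define b :: "real^2" where "b = vector [cos (\<theta> + \<omega>/2), sin (\<theta> + \<omega>/2)]"
  define C where "C = {y. cos (\<omega> / 2) * norm (y - c) \<le> b \<bullet> (y - c)}"
  have unit: "norm (vector [cos x, sin x] :: real^2) = 1" for x
    by (simp add: norm_vec_def L2_set_def sum_2 vector_2)
  have "\<Omega> \<inter> ball c r \<subseteq> C"
  proof
    fix y assume "y \<in> \<Omega> \<inter> ball c r"
    then obtain \<rho> \<phi> where y: "y = c + \<rho> *\<^sub>R vector [cos \<phi>, sin \<phi>]" "0 < \<rho>"
      and phi: "\<theta> < \<phi>" "\<phi> < \<theta> + \<omega>" unfolding S by blast
    have "\<bar>\<theta> + \<omega>/2 - \<phi>\<bar> \<le> \<omega>/2" using phi by linarith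
    then have "cos (\<omega>/2) \<le> cos \<bar>\<theta> + \<omega>/2 - \<phi>\<bar>"
      using om by (intro cos_monotone_0_pi_le) auto
    also have "\<dots> = cos (\<theta> + \<omega>/2 - \<phi>)" by simp
    also have "\<dots> = b \<bullet> vector [cos \<phi>, sin \<phi>]"
      unfolding cos_diff b_def by (simp add: inner_vec_def sum_2 vector_2)
    finally show "y \<in> C" using y unit by (simp add: C_def mult.commute)
  qed
  moreover have "closed C" unfolding C_def by (intro closed_Collect_le continuous_intros)
  ultimately have "ball c r \<inter> closure \<Omega> \<subseteq> C"
    by (metis closure_minimal inf_commute open_Int_closure_subset open_ball order_trans)
  then have "\<forall>\<^sub>F y in nhds c. y \<in> closure \<Omega> \<longrightarrow> y \<in> C"
    using r by (intro eventually_nhds_in_open[THEN eventually_mono, of "ball c r"]) auto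
  then show ?thesis using that[of b] unit by (simp add: C_def b_def)
qed

text \<open>The direction opposite to the bisector would have to lie in the cone, which forces cos
  (\<omega>/2) to be at most -1, although \<omega>/2 is less than pi.\<close>

lemma interior_angle_not_full:
  assumes "has_interior_angle \<Omega> c \<omega>"
  shows "\<not> (\<forall>\<^sub>F y in nhds c. y \<in> closure \<Omega>)"
proof
  assume full: "\<forall>\<^sub>F y in nhds c. y \<in> closure \<Omega>"
  obtain b where b: "norm b = 1"
    and cone: "\<forall>\<^sub>F y in nhds c. y \<in> closure \<Omega> \<longrightarrow> cos (\<omega> / 2) * norm (y - c) \<le> b \<bullet> (y - c)"
    using closure_in_cone[OF assms] .
  have "\<forall>\<^sub>F y in nhds c. cos (\<omega> / 2) * norm (y - c) \<le> b \<bullet> (y - c)"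
    using cone full by eventually_elim blast
  from eventually_nhds_ray[OF this, of "- b"]
  have "\<forall>\<^sub>F s in at_right 0. cos (\<omega> / 2) * (\<bar>s\<bar> * norm b) \<le> - (s * (b \<bullet> b))" by simp
  then have "\<forall>\<^sub>F s in at_right (0::real). cos (\<omega> / 2) \<le> -1"
    using eventually_at_right_less[of 0]
  proof eventually_elim
    case (elim s)
    then have "s * cos (\<omega> / 2) \<le> s * (-1)" using b by (simp add: dot_square_norm mult.commute)
    then show ?case using elim(2) by (rule mult_left_le_imp_le)
  qed
  then have "cos (\<omega> / 2) \<le> cos pi" by (simp add: trivial_limit_at_right_real)
  moreover have "cos pi < cos (\<omega> / 2)"
    using assms by (intro cos_monotone_0_pi) (auto simp: has_interior_angle_def)
  ultimately show False by simp
qed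

text \<open>If \<omega> < pi, the cone around the closure contains no line, whereas a half plane
  contains its boundary line. If \<omega> > pi, the sector contains opposite directions, on which
  \<open>n\<close> must vanish; two independent ones force \<open>n\<close> to be zero.\<close>

lemma interior_angle_half_plane:
  assumes ang: "has_interior_angle \<Omega> c \<omega>" and n: "n \<noteq> 0"
    and half: "\<forall>\<^sub>F y in nhds c. y \<in> closure \<Omega> \<longleftrightarrow> n \<bullet> (y - c) \<le> 0"
  shows "\<omega> = pi"
proof (rule linorder_cases)
  assume "\<omega> < pi"
  obtain b where b: "norm b = 1"
    and "\<forall>\<^sub>F y in nhds c. y \<in> closure \<Omega> \<longrightarrow> cos (\<omega> / 2) * norm (y - c) \<le> b \<bullet> (y - c)"
    using closure_in_cone[OF ang] .
  then have cone: "\<forall>\<^sub>F y in nhds c. n \<bullet> (y - c) \<le> 0 \<longrightarrow> cos (\<omega> / 2) * norm (y - c) \<le> b \<bullet> (y - c)"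
    using half by eventually_elim auto
  \<comment> \<open>The direction of the boundary line of the half plane.\<close>
  define d :: "real^2" where "d = vector [n$2, - n$1]"
  have d: "n \<bullet> d = 0" "d \<noteq> 0"
    using n by (auto simp: d_def inner_vec_def sum_2 vector_2 vec_eq_iff forall_2)
  have pos: "cos (\<omega> / 2) > 0"
    using \<open>\<omega> < pi\<close> ang by (intro cos_gt_zero_pi) (auto simp: has_interior_angle_def)
  have "\<forall>\<^sub>F s in at_right (0::real). False"
    using eventually_nhds_ray[OF cone, of d] eventually_nhds_ray[OF cone, of "- d"]
      eventually_at_right_less[of 0]
  proof eventually_elim
    case (elim s)
    then have "cos (\<omega> / 2) * (s * norm d) \<le> s * (b \<bullet> d)"
      "cos (\<omega> / 2) * (s * norm d) \<le> - (s * (b \<bullet> d))" using d by auto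
    then have "cos (\<omega> / 2) * (s * norm d) \<le> 0" by linarith
    then show ?case using pos elim(3) d(2) by (simp add: mult_le_0_iff)
  qed
  then show ?thesis by (simp add: trivial_limit_at_right_real)
next
  assume "pi < \<omega>"
  obtain r \<theta> where r: "r > 0"
    and S: "\<Omega> \<inter> ball c r = {c + \<rho> *\<^sub>R vector [cos \<phi>, sin \<phi>] | \<rho> \<phi>.
              0 < \<rho> \<and> \<rho> < r \<and> \<theta> < \<phi> \<and> \<phi> < \<theta> + \<omega>}"
    using ang by (auto simp: has_interior_angle_def)
  have le: "n \<bullet> vector [cos \<phi>, sin \<phi>] \<le> 0" if phi: "\<theta> < \<phi>" "\<phi> < \<theta> + \<omega>" for \<phi>
  proof -
    have "\<forall>\<^sub>F s in at_right (0::real). n \<bullet> vector [cos \<phi>, sin \<phi>] \<le> 0"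
      using eventually_nhds_ray[OF half, of "vector [cos \<phi>, sin \<phi>]"]
        eventually_at_right_less[of 0] eventually_at_right_real[OF r]
    proof eventually_elim
      case (elim s)
      then have "c + s *\<^sub>R vector [cos \<phi>, sin \<phi>] \<in> \<Omega> \<inter> ball c r"
        unfolding S using phi by auto
      then have "c + s *\<^sub>R vector [cos \<phi>, sin \<phi>] \<in> closure \<Omega>" using closure_subset by auto
      then show ?case using elim by (simp add: mult_le_0_iff)
    qed
    then show ?thesis by (simp add: trivial_limit_at_right_real)
  qed
  \<comment> \<open>Both \<phi> and \<phi> + pi lie in the sector, so the pairing with
    \<open>n\<close> is nonpositive for a vector and for its negative.\<close>
  have eq: "n$1 * cos \<phi> + n$2 * sin \<phi> = 0" if phi: "\<theta> < \<phi>" "\<phi> < \<theta> + (\<omega> - pi)" for \<phi>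
  proof -
    have "n \<bullet> vector [cos (\<phi> + pi), sin (\<phi> + pi)] \<le> 0" "n \<bullet> vector [cos \<phi>, sin \<phi>] \<le> 0"
      using phi pi_gt_zero \<open>pi < \<omega>\<close> by (intro le; linarith)+
    then show ?thesis by (simp add: inner_vec_def sum_2 vector_2)
  qed
  \<comment> \<open>Cutting the excess \<omega> - pi into thirds puts two distinct angles strictly
    inside the admissible range; they differ by less than pi, so their directions are
    independent.\<close>
  define \<epsilon> where "\<epsilon> = (\<omega> - pi) / 3"
  have eps: "0 < \<epsilon>" "\<epsilon> < pi" using \<open>pi < \<omega>\<close> ang by (auto simp: \<epsilon>_def has_interior_angle_def)
  define \<phi> \<psi> where "\<phi> = \<theta> + \<epsilon>" and "\<psi> = \<theta> + 2 * \<epsilon>"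
  have e1: "n$1 * cos \<phi> + n$2 * sin \<phi> = 0" and e2: "n$1 * cos \<psi> + n$2 * sin \<psi> = 0"
    using \<open>pi < \<omega>\<close> by (intro eq; simp add: \<phi>_def \<psi>_def \<epsilon>_def)+
  have "sin (\<psi> - \<phi>) > 0" using eps by (intro sin_gt_zero) (auto simp: \<phi>_def \<psi>_def)
  then have s: "sin \<psi> * cos \<phi> - cos \<psi> * sin \<phi> \<noteq> 0" by (simp add: sin_diff)
  have "n$1 * (sin \<psi> * cos \<phi> - cos \<psi> * sin \<phi>) = 0" "n$2 * (sin \<psi> * cos \<phi> - cos \<psi> * sin \<phi>) = 0"
    using e1 e2 by algebra+
  with s have "n = 0" by (simp add: vec_eq_iff forall_2)
  with n show ?thesis by simp
qed

section \<open>Edges as segments and their chosen end points\<close>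

lemma edge_is_segment:
  fixes K :: "'a::euclidean_space set"
  assumes "polytope K" "e edge_of K"
  obtains a b where "e = closed_segment a b" "a \<noteq> b"
proof -
  have e: "e face_of K" "aff_dim e = 1" using assms by (auto simp: edge_of_def)
  then have "compact e" "convex e" "collinear e"
    using face_of_polytope_polytope assms(1) polytope_imp_compact polytope_imp_convex
    by (auto simp: collinear_aff_dim)
  moreover have "e \<noteq> {}" using e(2) by auto
  ultimately obtain a b where ab: "e = closed_segment a b"
    using compact_convex_collinear_segment by blast
  then have "a \<noteq> b" using e(2) by auto
  with ab that show ?thesis by blast
qed

lemma edge_ends_segment:
  assumes "e = closed_segment a b"
  shows "e = closed_segment (fst (edge_ends e)) (snd (edge_ends e))"
proof -
  have "case edge_ends e of (a, b) \<Rightarrow> e = closed_segment a b"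
    unfolding edge_ends_def by (rule someI[of _ "(a, b)"]) (use assms in auto)
  then show ?thesis by (simp add: case_prod_beta)
qed

subsection \<open>Edges of a mesh\<close>

locale polygonal_mesh =
  fixes \<Omega> :: "point set" and T :: "point set set"
  assumes domain: "polygonal_domain \<Omega>" and mesh: "conforming_triangulation \<Omega> T"
begin

lemma finite_T [simp]: "finite T"
  and triangle: "K \<in> T \<Longrightarrow> 2 simplex K"
  and triangles_meet: "K \<in> T \<Longrightarrow> K' \<in> T \<Longrightarrow> K \<inter> K' face_of K"
  and cover: "\<Union>T = closure \<Omega>"
  and open_domain: "open \<Omega>"
  using mesh domain
  by (auto simp: conforming_triangulation_def triangulation_def polygonal_domain_def)

lemma closed_triangle: "K \<in> T \<Longrightarrow> closed K"
  by (intro polytope_imp_closed simplex_imp_polytope[OF triangle])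

lemma finite_edges_of: "K \<in> T \<Longrightarrow> finite {e. e edge_of K}"
  using finite_polytope_faces[OF simplex_imp_polytope[OF triangle]]
  by (rule finite_subset[rotated]) (auto simp: edge_of_def)

lemma finite_edges [simp]: "finite (edges T)"
proof -
  have "edges T = (\<Union>K\<in>T. {e. e edge_of K})" by (auto simp: edges_def)
  then show ?thesis using finite_edges_of by simp
qed

lemma finite_triangles_at [simp]: "finite (triangles_at T e)"
  by (simp add: triangles_at_def)

lemma edges_eq: "edges T = int_edges \<Omega> T \<union> bd_edges \<Omega> T"
  and edges_disjoint: "int_edges \<Omega> T \<inter> bd_edges \<Omega> T = {}"
  by (auto simp: int_edges_def bd_edges_def)

lemma edge_closed_segment:
  assumes "e \<in> edges T"
  shows "e = closed_segment (fst (edge_ends e)) (snd (edge_ends e))"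
    and "fst (edge_ends e) \<noteq> snd (edge_ends e)"
proof -
  obtain K where K: "K \<in> T" "e edge_of K" using assms by (auto simp: edges_def)
  then obtain a b where ab: "e = closed_segment a b" "a \<noteq> b"
    using edge_is_segment[OF simplex_imp_polytope[OF triangle]] by blast
  show e: "e = closed_segment (fst (edge_ends e)) (snd (edge_ends e))"
    using edge_ends_segment[OF ab(1)] .
  show "fst (edge_ends e) \<noteq> snd (edge_ends e)"
    proof
    assume "fst (edge_ends e) = snd (edge_ends e)"
    then have "closed_segment a b = {fst (edge_ends e)}" using e ab by (metis closed_segment_idem)
    then show False using ab(2) by (simp add: closed_segment_eq_sing)
  qed
qed

text \<open>A triangle containing \<open>m\<close> has \<open>e\<close> as an edge: its intersection
  with \<open>K0\<close> is a face of \<open>K0\<close> that meets the relative interior of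
  \<open>e\<close>, so it contains \<open>e\<close>. The remaining triangles are finitely many
  closed sets missing \<open>m\<close>, hence a neighbourhood of \<open>m\<close>.\<close>

lemma triangles_at_near:
  assumes e: "e \<in> edges T" "e = closed_segment a b" and m: "m \<in> open_segment a b"
  shows "\<forall>\<^sub>F x in nhds m. x \<in> closure \<Omega> \<longleftrightarrow>
           (\<exists>K\<in>triangles_at T e. outer_normal K e \<bullet> (x - m) \<le> 0)"
proof -
  obtain K0 where K0: "K0 \<in> T" "e edge_of K0" using e by (auto simp: edges_def)
  have ab: "a \<noteq> b" using m by auto
  have "m \<in> e" using m e(2) segment_open_subset_closed by blast
  have edge: "e edge_of K" if K: "K \<in> T" "m \<in> K" for K
  proof -
    have "m \<in> rel_interior e" unfolding e(2) using ab m by (simp only: rel_interior_closed_segment if_False)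
    moreover have "m \<in> K0 \<inter> K" using K \<open>m \<in> e\<close> K0(2) edge_of_imp_subset by auto
    ultimately have "e \<subseteq> K0 \<inter> K"
      using triangles_meet[OF K0(1) K(1)] edge_of_imp_subset[OF K0(2)]
        subset_of_face_of[of "K0 \<inter> K" K0 e] by blast
    then have "e face_of K0 \<inter> K"
      using K0(2) face_of_subset[of e K0 "K0 \<inter> K"] by (simp add: edge_of_def)
    moreover have "K0 \<inter> K face_of K"
      using triangles_meet[OF K(1) K0(1)] by (simp add: Int_commute)
    ultimately show ?thesis using K0(2) by (metis edge_of_def face_of_trans)
  qed
  have "\<forall>\<^sub>F x in nhds m. x \<in> K \<longleftrightarrow> K \<in> triangles_at T e \<and> outer_normal K e \<bullet> (x - m) \<le> 0"
    if K: "K \<in> T" for K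
  proof (cases "m \<in> K")
    case True
    then have "e edge_of K" using edge K by blast
    then show ?thesis
      using triangle_near_edge[OF triangle[OF K] _ m] K unfolding e(2) by (simp add: triangles_at_def)
  next
    case False
    then have "\<forall>\<^sub>F x in nhds m. x \<in> - K"
      using closed_triangle[OF K] by (intro eventually_nhds_in_open) auto
    moreover have "K \<notin> triangles_at T e"
      using False \<open>m \<in> e\<close> edge_of_imp_subset by (auto simp: triangles_at_def)
    ultimately show ?thesis by (auto elim: eventually_mono)
  qed
  then have "\<forall>\<^sub>F x in nhds m. \<forall>K\<in>T. x \<in> K \<longleftrightarrow>
      K \<in> triangles_at T e \<and> outer_normal K e \<bullet> (x - m) \<le> 0"
    by (simp add: eventually_ball_finite)
  then show ?thesis

    unfolding cover[symmetric] by eventually_elim (auto simp: triangles_at_def)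
qed

lemma triangles_atD: "K \<in> triangles_at T e \<Longrightarrow> K \<in> T \<and> e edge_of K \<and> e \<in> edges T"
  by (auto simp: triangles_at_def edges_def)

lemma norm_outer_normal:
  assumes "K \<in> triangles_at T e"
  shows "norm (outer_normal K e) = 1"
proof -
  have K: "K \<in> T" "e edge_of K" "e \<in> edges T" using triangles_atD[OF assms] by auto
  obtain a b where ab: "e = closed_segment a b" using edge_closed_segment(1)[OF K(3)] by blast
  obtain c where "K = convex hull {a, b, c}" "\<not> collinear {a, b, c}"
    using edge_of_triangle[OF triangle[OF K(1)]] K(2) ab by blast
  then show ?thesis using outer_normal_triangle(1) ab by blast
qed

text \<open>Both triangles contain the same half disc around a point inside the edge, so a small
  step along \<open>- n\<close> reaches a common interior point. A face of a triangle that meets its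
  interior is the whole triangle, and \<open>K \<inter> K'\<close> is a face of each.\<close>

lemma triangles_at_same_normal:
  assumes K: "K \<in> triangles_at T e" "K' \<in> triangles_at T e"
    and eq: "outer_normal K e = outer_normal K' e"
  shows "K = K'"
proof -
  obtain a b where ab: "e = closed_segment a b" "a \<noteq> b"
    using edge_closed_segment triangles_atD[OF K(1)] by blast
  obtain m where m: "m \<in> open_segment a b" using ab midpoint_in_open_segment by blast
  define n where "n = outer_normal K e"
  have n: "norm n = 1" using norm_outer_normal K by (simp add: n_def)
  have near: "\<forall>\<^sub>F x in nhds m. x \<in> J \<longleftrightarrow> n \<bullet> (x - m) \<le> 0"
    if J: "J \<in> triangles_at T e" "outer_normal J e = n" for J
    using triangle_near_edge[OF triangle _ m, of J] J triangles_atD[OF J(1)] ab by simp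
  have "\<forall>\<^sub>F x in nhds m. n \<bullet> (x - m) \<le> 0 \<longrightarrow> x \<in> K \<inter> K'"
    using near[OF K(1) n_def[symmetric]] near[OF K(2)  eq[symmetric, folded n_def]]
    by eventually_elim blast
  then obtain U where U: "open U" "m \<in> U" "\<And>x. x \<in> U \<Longrightarrow> n \<bullet> (x - m) \<le> 0 \<Longrightarrow> x \<in> K \<inter> K'"
    by (auto simp: eventually_nhds)
  have "\<forall>\<^sub>F s in at_right 0. m + s *\<^sub>R (- n) \<in> U"
    using eventually_nhds_ray[OF eventually_nhds_in_open[OF U(1,2)]] .
  then have "\<forall>\<^sub>F s in at_right 0. s > 0 \<and> m - s *\<^sub>R n \<in> U"
    using eventually_at_right_less[of 0] by eventually_elim simp
  then obtain s where s: "s > 0" "m - s *\<^sub>R n \<in> U"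
    using eventually_happens'[OF trivial_limit_at_right_real] by blast
  \<comment> \<open>The open half disc; it makes the point interior to both triangles and not merely
    a member.\<close>
  define V where "V = U \<inter> {x. n \<bullet> (x - m) < 0}"
  have "open V" unfolding V_def using U by (intro open_Int open_Collect_less continuous_intros)
  moreover have "V \<subseteq> K \<inter> K'" using U by (auto simp: V_def)
  moreover have x: "m - s *\<^sub>R n \<in> V" using s n by (simp add: V_def dot_square_norm)
  ultimately have "m - s *\<^sub>R n \<in> interior K" "m - s *\<^sub>R n \<in> interior K'"
    by (auto intro: interiorI)
  then have ri: "m - s *\<^sub>R n \<in> rel_interior K" "m - s *\<^sub>R n \<in> rel_interior K'"
    using interior_subset_rel_interior by auto
  have "m - s *\<^sub>R n \<in> K \<inter> K'" using x \<open>V \<subseteq> K \<inter> K'\<close> by blast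
  then have "K \<subseteq> K \<inter> K'" "K' \<subseteq> K' \<inter> K"
    using ri triangles_meet triangles_atD[OF K(1)] triangles_atD[OF K(2)]
      subset_of_face_of[of "K \<inter> K'" K K] subset_of_face_of[of "K' \<inter> K" K' K']
    by blast+
  then show ?thesis by blast
qed

text \<open>Both normals are unit vectors orthogonal to the edge, so they agree up to sign, and
  equality would identify the triangles.\<close>

lemma triangles_at_opposite_normal:
  assumes K: "K \<in> triangles_at T e" "K' \<in> triangles_at T e" "K \<noteq> K'"
  shows "outer_normal K' e = - outer_normal K e"
proof -
  obtain a b where ab: "e = closed_segment a b" "a \<noteq> b"
    using edge_closed_segment triangles_atD[OF K(1)] by blast
  have perp: "outer_normal J e \<bullet> (b - a) = 0" if "J \<in> triangles_at T e" for J
  proof -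
    have J: "J \<in> T" "e edge_of J" using triangles_atD[OF that] by auto
    then obtain c where "J = convex hull {a, b, c}" "\<not> collinear {a, b, c}"
      using edge_of_triangle[OF triangle[OF J(1)]] ab by blast
    then show ?thesis using outer_normal_triangle(2) ab by blast
  qed
  define n n' where "n = outer_normal K e" and "n' = outer_normal K' e"
  have n: "norm n = 1" "norm n' = 1" using norm_outer_normal K by (auto simp: n_def n'_def)
  have "n' = ((n' \<bullet> n) / (n \<bullet> n)) *\<^sub>R n"
    using ab n perp[OF K(1)] perp[OF K(2)] unfolding n_def n'_def
    by (intro orthogonal_complement_plane[of "b - a"]) (auto simp: inner_commute)
  then obtain s where s: "n' = s *\<^sub>R n" by blast
  then have "\<bar>s\<bar> = 1" using n by simp
  moreover have "n' \<noteq> n" using triangles_at_same_normal K by (auto simp: n_def n'_def)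
  ultimately have "s = -1" using s by (cases "s \<ge> 0") auto
  then show ?thesis using s by (simp add: n_def n'_def)
qed

lemma near_two_triangles:
  assumes K: "K \<in> triangles_at T e" "K' \<in> triangles_at T e" "K \<noteq> K'"
    and e: "e = closed_segment a b" and m: "m \<in> open_segment a b"
  shows "\<forall>\<^sub>F x in nhds m. x \<in> closure \<Omega>"
proof -
  have eT: "e \<in> edges T" using triangles_atD K by blast
  show ?thesis
    using triangles_at_near[OF eT e m]
  proof eventually_elim
    case (elim x)
    have "outer_normal K' e \<bullet> (x - m) = - (outer_normal K e \<bullet> (x - m))"
      using triangles_at_opposite_normal[OF K] by simp
    then have "outer_normal K e \<bullet> (x - m) \<le> 0 \<or> outer_normal K' e \<bullet> (x - m) \<le> 0" by linarith
    then show ?case using elim K by blast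
  qed
qed

lemma near_one_triangle:
  assumes K: "triangles_at T e = {K}" and e: "e = closed_segment a b" and m: "m \<in> open_segment a b"
  shows "\<forall>\<^sub>F x in nhds m. x \<in> closure \<Omega> \<longleftrightarrow> outer_normal K e \<bullet> (x - m) \<le> 0"
  using triangles_at_near[OF _ e m] K triangles_atD[of K e] by simp

text \<open>A third triangle would have the normal opposite to that of the first, which is the
  normal of the second, and would coincide with it.\<close>

lemma triangles_at_cases:
  assumes "e \<in> edges T"
  obtains (one) K where "triangles_at T e = {K}"
  | (two) K K' where "triangles_at T e = {K, K'}" "K \<noteq> K'"
proof -
  obtain K where K: "K \<in> triangles_at T e" using assms by (auto simp: edges_def triangles_at_def)
  show ?thesis
  proof (cases "triangles_at T e = {K}")
    case False
    then obtain K' where K': "K' \<in> triangles_at T e" "K' \<noteq> K" using K by blast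
    have "J = K \<or> J = K'" if J: "J \<in> triangles_at T e" for J
    proof (cases "J = K")
      case False
      then have "outer_normal J e = outer_normal K' e"
        using triangles_at_opposite_normal[OF K J] triangles_at_opposite_normal[OF K K'(1)] K' by auto
      then show ?thesis using triangles_at_same_normal J K' by blast
    qed simp
    then have "triangles_at T e = {K, K'}" using K K' by blast
    with K' that show ?thesis by blast
  qed (use that in blast)
qed

section \<open>Triangle counts for boundary and interior edges\<close>

lemma not_full_at_frontier:
  assumes "c \<in> frontier \<Omega>"
  shows "\<not> (\<forall>\<^sub>F y in nhds c. y \<in> closure \<Omega>)"
  using assms domain interior_angle_not_full by (auto simp: polygonal_domain_def)

text \<open>Two triangles would fill a neighbourhood of the midpoint, so the edge would be a crack
  in the domain. The equation also gives meaning to the definite description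
  \<open>bd_triangle\<close>.\<close>

lemma triangles_at_bd_edge:
  assumes e: "e \<in> bd_edges \<Omega> T"
  shows "triangles_at T e = {bd_triangle T e}"
proof -
  have eT: "e \<in> edges T" and fr: "e \<subseteq> frontier \<Omega>" using e by (auto simp: bd_edges_def)
  obtain a b where ab: "e = closed_segment a b" "a \<noteq> b" using edge_closed_segment[OF eT] by blast
  have m: "midpoint a b \<in> open_segment a b" using ab by simp
  from eT obtain K where K: "triangles_at T e = {K}"
  proof (cases rule: triangles_at_cases)
    case (two K K')
    then have "\<forall>\<^sub>F x in nhds (midpoint a b). x \<in> closure \<Omega>"
      using near_two_triangles[OF _ _ _ ab(1) m, of K K'] by simp
    moreover have "midpoint a b \<in> frontier \<Omega>" using fr ab by auto
    ultimately show ?thesis using not_full_at_frontier by blast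
  qed
  then have "J \<in> T \<and> e edge_of J \<longleftrightarrow> J = K" for J unfolding triangles_at_def by blast
  then have "bd_triangle T e = K" unfolding bd_triangle_def by simp
  with K show ?thesis by simp
qed

lemma triangles_at_int_edge:
  assumes e: "e \<in> int_edges \<Omega> T"
  obtains K K' where "triangles_at T e = {K, K'}" "K \<noteq> K'"
    "norm (outer_normal K e) = 1" "outer_normal K' e = - outer_normal K e"
proof -
  have eT: "e \<in> edges T" and nfr: "\<not> e \<subseteq> frontier \<Omega>"
    using e by (auto simp: int_edges_def bd_edges_def)
  obtain a b where ab: "e = closed_segment a b" "a \<noteq> b" using edge_closed_segment[OF eT] by blast
  have "e \<subseteq> closure \<Omega>"
    using eT cover by (auto simp: edges_def dest!: edge_of_imp_subset)
  then have "e \<inter> \<Omega> \<noteq> {}"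
    using nfr open_domain by (auto simp: frontier_def interior_open)
  \<comment> \<open>An interior edge is only known not to lie wholly in the frontier. The open
    segment is dense in it and the domain is open, so a point of the domain can be found away from
    the end points.\<close>
  then have "closure (open_segment a b) \<inter> \<Omega> \<noteq> {}"
    using ab by (simp add: closure_open_segment)
  then obtain m where m: "m \<in> open_segment a b" "m \<in> \<Omega>"
    using open_domain by (metis Int_commute disjoint_iff open_Int_closure_eq_empty)
  have full: "\<forall>\<^sub>F x in nhds m. x \<in> closure \<Omega>"
    using eventually_nhds_in_open[OF open_domain m(2)]
    by (rule eventually_mono) (use closure_subset in blast)
  from eT obtain K K' where K: "triangles_at T e = {K, K'}" "K \<noteq> K'"
  proof (cases rule: triangles_at_cases)
    case (one K)
    define n where "n = outer_normal K e"
    have n: "norm n = 1" using one norm_outer_normal by (simp add: n_def)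
    have "\<forall>\<^sub>F x in nhds m. n \<bullet> (x - m) \<le> 0"
      using near_one_triangle[OF one ab(1) m(1)] full
      unfolding n_def by eventually_elim simp
    \<comment> \<open>Moving outward along \<open>n\<close> leaves the half plane of the only
      triangle at once.\<close>
    from eventually_nhds_ray[OF this, of n] have "\<forall>\<^sub>F s in at_right (0::real). s \<le> 0"
      using n by (simp add: dot_square_norm)
    then have "\<forall>\<^sub>F s in at_right (0::real). False"
      using eventually_at_right_less[of 0] by eventually_elim simp
    then show ?thesis by (simp add: trivial_limit_at_right_real)
  qed
  then show ?thesis
    using that[OF K] norm_outer_normal[of K e] triangles_at_opposite_normal[of K e K'] by simp
qed

section \<open>The penalty weight is nonzero\<close>

lemma midpoint_not_corner:
  assumes e: "e \<in> edges T"
  shows "edge_midpoint e \<notin> corners \<Omega>"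
proof
  assume "edge_midpoint e \<in> corners \<Omega>"
  then obtain \<omega> where fr: "edge_midpoint e \<in> frontier \<Omega>"
    and ang: "has_interior_angle \<Omega> (edge_midpoint e) \<omega>" "\<omega> \<noteq> pi"
    by (auto simp: corners_def)
  define a b where "a = fst (edge_ends e)" and "b = snd (edge_ends e)"
  have ab: "e = closed_segment a b" "a \<noteq> b" using edge_closed_segment[OF e] by (auto simp: a_def b_def)
  then have m: "edge_midpoint e \<in> open_segment a b"
    unfolding edge_midpoint_def a_def[symmetric] b_def[symmetric] by simp
  from e show False
  proof (cases rule: triangles_at_cases)
    case (one K)
    then have "norm (outer_normal K e) = 1" using norm_outer_normal by simp
    then have "\<omega> = pi"
      using interior_angle_half_plane[OF ang(1) _ near_one_triangle[OF one ab(1) m]] by force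
    with ang show False by blast
  next
    case (two K K')
    then show False
      using near_two_triangles[OF _ _ _ ab(1) m, of K K'] not_full_at_frontier[OF fr] by simp
  qed
qed

lemma penalty_nonzero:
  assumes "e \<in> edges T"
  shows "penalty \<Omega> \<mu> e \<noteq> 0"
proof -
  \<comment> \<open>\<open>powr\<close> is zero only for base zero, so the factor vanishes only if
    the midpoint is \<open>c\<close> itself.\<close>
  have "norm (edge_midpoint e - c) powr (1 - \<mu> c) \<noteq> 0" if "c \<in> corners \<Omega>" for c
    using midpoint_not_corner[OF assms] that by auto
  then have "Phi \<Omega> \<mu> e \<noteq> 0"
    \<comment> \<open>A product over an infinite index set is 1 by convention, hence nonzero as
      well.\<close>
    unfolding Phi_def by (cases "finite (corners \<Omega>)") (auto simp: prod_zero_iff)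
  moreover have "edge_length e \<noteq> 0" using edge_closed_segment(2)[OF assms] by (simp add: edge_length_def)
  ultimately show ?thesis by (simp add: penalty_def)
qed

end

subsection \<open>Polynomials\<close>

text \<open>The nested sum, whose inner range depends on the outer index, becomes one sum over a set
  of exponent pairs; sums and changes of degree can then be handled coefficientwise.\<close>

lemma Poly_iff:
  "g \<in> Poly j S \<longleftrightarrow> (\<exists>c. \<forall>x\<in>S. g x =
     (\<Sum>(a, b) | a + b \<le> j. c a b * (x $ 1) ^ a * (x $ 2) ^ b))"
proof -
  have "(SIGMA a:{..j}. {..j - a}) = {(a, b). a + b \<le> j}" by auto
  then show ?thesis by (simp add: Poly_def sum.Sigma)
qed

lemma finite_exponents: "finite {(a, b). a + b \<le> (j :: nat)}"
  by (rule finite_subset[of _ "{..j} \<times> {..j}"]) auto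

lemma Poly_mono:
  assumes "i \<le> j" "S \<subseteq> S'" "g \<in> Poly i S'"
  shows "g \<in> Poly j S"
proof -
  obtain c where c: "\<And>x. x \<in> S' \<Longrightarrow> g x = (\<Sum>(a, b) | a + b \<le> i. c a b * (x $ 1) ^ a * (x $ 2) ^ b)"
    using assms(3) by (auto simp: Poly_iff)
  \<comment> \<open>The given coefficients are arbitrary beyond degree \<open>i\<close> and have to
    be cut off there.\<close>
  define c' where "c' a b = (if a + b \<le> i then c a b else 0)" for a b
  have "g x = (\<Sum>(a, b) | a + b \<le> j. c' a b * (x $ 1) ^ a * (x $ 2) ^ b)" if x: "x \<in> S" for x
  proof -
    have "g x = (\<Sum>(a, b) | a + b \<le> i. c a b * (x $ 1) ^ a * (x $ 2) ^ b)"
      using c x assms(2) by blast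
    also have "\<dots> = (\<Sum>(a, b) | a + b \<le> j. c' a b * (x $ 1) ^ a * (x $ 2) ^ b)"
      using assms(1) finite_exponents[of j]
      by (intro sum.mono_neutral_cong_left) (auto simp: c'_def split: if_splits)
    finally show ?thesis .
  qed
  then show ?thesis unfolding Poly_iff by blast
qed

lemma Poly_add:
  assumes "g \<in> Poly j S" "h \<in> Poly j S"
  shows "(\<lambda>x. g x + h x) \<in> Poly j S"
proof -
  obtain c d where
    "\<And>x. x \<in> S \<Longrightarrow> g x = (\<Sum>(a, b) | a + b \<le> j. c a b * (x $ 1) ^ a * (x $ 2) ^ b)"
    "\<And>x. x \<in> S \<Longrightarrow> h x = (\<Sum>(a, b) | a + b \<le> j. d a b * (x $ 1) ^ a * (x $ 2) ^ b)"
    using assms by (auto simp: Poly_iff)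
  then have "\<forall>x\<in>S. g x + h x = (\<Sum>(a, b) | a + b \<le> j. (c a b + d a b) * (x $ 1) ^ a * (x $ 2) ^ b)"
    by (simp add: sum.distrib[symmetric] case_prod_beta algebra_simps)
  then show ?thesis unfolding Poly_iff by (intro exI[of _ "\<lambda>a b. c a b + d a b"])
qed

lemma Poly_cmult:
  assumes "g \<in> Poly j S"
  shows "(\<lambda>x. r * g x) \<in> Poly j S"
proof -
  obtain c where "\<And>x. x \<in> S \<Longrightarrow> g x = (\<Sum>(a, b) | a + b \<le> j. c a b * (x $ 1) ^ a * (x $ 2) ^ b)"
    using assms by (auto simp: Poly_iff)
  then have "\<forall>x\<in>S. r * g x = (\<Sum>(a, b) | a + b \<le> j. (r * c a b) * (x $ 1) ^ a * (x $ 2) ^ b)"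
    by (simp add: sum_distrib_left case_prod_beta algebra_simps)
  then show ?thesis unfolding Poly_iff by (intro exI[of _ "\<lambda>a b. r * c a b"])
qed

lemma Poly_zero: "(\<lambda>x. 0) \<in> Poly j S"
  unfolding Poly_def by (intro CollectI exI[of _ "\<lambda>a b. 0"]) simp

lemma Poly_continuous_on:
  assumes "g \<in> Poly j S"
  shows "continuous_on S g"
proof -
  obtain c where "\<And>x. x \<in> S \<Longrightarrow> g x = (\<Sum>a\<le>j. \<Sum>b\<le>j - a. c a b * (x $ 1) ^ a * (x $ 2) ^ b)"
    using assms by (auto simp: Poly_def)
  then show ?thesis
    by (subst continuous_on_cong[OF refl]) (auto intro!: continuous_intros)
qed

lemma Poly2_mono: "i \<le> j \<Longrightarrow> S \<subseteq> S' \<Longrightarrow> g \<in> Poly2 i S' \<Longrightarrow> g \<in> Poly2 j S"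
  using Poly_mono by (auto simp: Poly2_def)

lemma Poly2_zero: "(\<lambda>x. 0) \<in> Poly2 j S"
  by (simp add: Poly2_def Poly_zero)

lemma Poly2_add: "g \<in> Poly2 j S \<Longrightarrow> h \<in> Poly2 j S \<Longrightarrow> (\<lambda>x. g x + h x) \<in> Poly2 j S"
  by (simp add: Poly2_def Poly_add)

lemma Poly2_scaleR: "g \<in> Poly2 j S \<Longrightarrow> (\<lambda>x. r *\<^sub>R g x) \<in> Poly2 j S"
  by (simp add: Poly2_def Poly_cmult)

lemma Poly2_diff: "g \<in> Poly2 j S \<Longrightarrow> h \<in> Poly2 j S \<Longrightarrow> (\<lambda>x. g x - h x) \<in> Poly2 j S"
  using Poly2_add[OF _ Poly2_scaleR[of h j S "-1"]] by simp

lemma Poly2_sum: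
  "(\<And>i. i \<in> I \<Longrightarrow> g i \<in> Poly2 j S) \<Longrightarrow> (\<lambda>x. \<Sum>i\<in>I. g i x) \<in> Poly2 j S"
  by (induction I rule: infinite_finite_induct) (simp_all add: Poly2_zero Poly2_add)

text \<open>For \<open>m = n\<close> a unit normal this is the normal part of a field, needed to
  build test functions on boundary edges.\<close>

lemma Poly2_inner_scaleR:
  assumes "g \<in> Poly2 j S"
  shows "(\<lambda>x. (g x \<bullet> n) *\<^sub>R m) \<in> Poly2 j S"
proof -
  have g: "(\<lambda>x. g x $ i) \<in> Poly j S" for i using assms by (simp add: Poly2_def)
  have "(\<lambda>x. n $ 1 * g x $ 1 + n $ 2 * g x $ 2) \<in> Poly j S"
    by (intro Poly_add Poly_cmult g)
  then have "(\<lambda>x. m $ i * (n $ 1 * g x $ 1 + n $ 2 * g x $ 2)) \<in> Poly j S" for i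
    by (rule Poly_cmult)
  then show ?thesis
    by (simp add: Poly2_def inner_vec_def sum_2 mult.commute)
qed

lemma Poly2_continuous_on:
  assumes "g \<in> Poly2 j S"
  shows "continuous_on S g"
proof -
  have "continuous_on S (\<lambda>x. g x $ i)" for i
    using assms Poly_continuous_on by (auto simp: Poly2_def)
  then have "continuous_on S (\<lambda>x. \<chi> i. g x $ i)" by (rule continuous_on_vec_lambda)
  then show ?thesis by simp
qed

subsection \<open>Integrals over an edge\<close>

text \<open>A single functional of scalar integrands, so that linearity and positivity are proved
  once for scalar, vector and matrix pairings.\<close>

definition edge_integral :: "point set \<Rightarrow> (point \<Rightarrow> real) \<Rightarrow> real" where
  "edge_integral e g = ip_edge e g (\<lambda>_. 1)"

lemma ip_edge_eq: "ip_edge e g h = edge_integral e (\<lambda>x. g x \<bullet> h x)"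
  by (simp add: edge_integral_def ip_edge_def)

locale edge =
  fixes e :: "point set"
  assumes ends: "e = closed_segment (fst (edge_ends e)) (snd (edge_ends e))"
    and ends_distinct: "fst (edge_ends e) \<noteq> snd (edge_ends e)"
begin

definition path :: "real \<Rightarrow> point" where
  "path t = (1 - t) *\<^sub>R fst (edge_ends e) + t *\<^sub>R snd (edge_ends e)"

lemma integral_path:
  "edge_integral e g = edge_length e * (LINT t:{0..1}|lborel. g (path t))"
  by (simp add: edge_integral_def ip_edge_def edge_length_def path_def case_prod_beta)

lemma path_image: "path ` {0..1} = e"
  using ends unfolding path_def closed_segment_image_interval by simp

lemma path_in: "t \<in> {0..1} \<Longrightarrow> path t \<in> e"
  using path_image by blast

lemma continuous_path:
  "continuous_on e g \<Longrightarrow> continuous_on {0..1} (\<lambda>t. g (path t))"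
  by (rule continuous_on_compose2[of e g])
    (use path_in in \<open>auto simp: path_def[abs_def] intro!: continuous_intros\<close>)

lemma integrable_path:
  "continuous_on e g \<Longrightarrow> set_integrable lborel {0..1} (\<lambda>t. g (path t) :: real)"
  by (rule borel_integrable_atLeastAtMost') (rule continuous_path)

lemma integral_cong:
  assumes "\<And>x. x \<in> e \<Longrightarrow> g x = h x"
  shows "edge_integral e g = edge_integral e h"
proof -
  have "(LINT t:{0..1}|lborel. g (path t)) = (LINT t:{0..1}|lborel. h (path t))"
    by (rule set_lebesgue_integral_cong) (auto simp: path_in assms)
  then show ?thesis by (simp add: integral_path)
qed

lemma integral_add:
  assumes "continuous_on e g" "continuous_on e h"
  shows "edge_integral e (\<lambda>x. g x + h x) = edge_integral e g + edge_integral e h"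
  using integrable_path[OF assms(1)] integrable_path[OF assms(2)]
  by (simp add: integral_path set_integral_add ring_distribs)

lemma integral_cmult: "edge_integral e (\<lambda>x. r * g x) = r * edge_integral e g"
  by (simp add: integral_path)

lemma integral_sum:
  assumes "\<And>i. i \<in> I \<Longrightarrow> continuous_on e (g i)"
  shows "edge_integral e (\<lambda>x. \<Sum>i\<in>I. g i x) = (\<Sum>i\<in>I. edge_integral e (g i))"
  using assms
proof (induction I rule: infinite_finite_induct)
  case (insert i I)
  then have "edge_integral e (\<lambda>x. g i x + (\<Sum>i\<in>I. g i x)) =
      edge_integral e (g i) + edge_integral e (\<lambda>x. \<Sum>i\<in>I. g i x)"
    by (intro integral_add continuous_on_sum) auto
  with insert show ?case by simp
qed (simp_all add: integral_path)

text \<open>The passage from integral identities to pointwise ones: after pulling back to [0, 1] and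
  dividing by the nonzero length, a continuous nonnegative function with zero integral
  remains.\<close>

lemma integral_nonneg_eq_0:
  assumes g: "continuous_on e g" "\<And>x. x \<in> e \<Longrightarrow> 0 \<le> g x"
    and zero: "edge_integral e g = 0" and x: "x \<in> e"
  shows "g x = 0"
proof -
  have c: "continuous_on {0..1} (\<lambda>t. g (path t))" by (rule continuous_path[OF g(1)])
  have "edge_length e \<noteq> 0" using ends_distinct by (simp add: edge_length_def)
  then have "(LINT t:{0..1}|lborel. g (path t)) = 0" using zero by (simp add: integral_path)
  \<comment> \<open>For a continuous integrand the Lebesgue and the gauge integral agree; the
    vanishing criterion is applied to the latter.\<close>
  then have "integral {0..1} (\<lambda>t. g (path t)) = 0"
    using set_borel_integral_eq_integral(2)[OF integrable_path[OF g(1)]] by simp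
  moreover obtain t where t: "t \<in> {0..1}" "x = path t" using x path_image by blast
  moreover have "\<And>t. t \<in> {0..1} \<Longrightarrow> 0 \<le> g (path t)" using g(2) path_in by blast
  ultimately show ?thesis
    using integral_eq_0_iff[OF c] by auto
qed

text \<open>Here \<open>s + r d\<close> vanishes, and testing \<open>s = - r d\<close> with \<open>s\<close> gives \<open>s = 0\<close>.\<close>

lemma flux_components_vanish:
  fixes s d :: "point \<Rightarrow> 'a::real_inner"
  assumes s: "continuous_on e s" and d: "continuous_on e d" and r: "r \<noteq> 0"
    and sq: "edge_integral e (\<lambda>x. (s x + r *\<^sub>R d x) \<bullet> (s x + r *\<^sub>R d x)) = 0"
    and orth: "edge_integral e (\<lambda>x. d x \<bullet> s x) = 0" and x: "x \<in> e"
  shows "s x = 0" "d x = 0"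
proof -
  have eq: "s y = (- r) *\<^sub>R d y" if "y \<in> e" for y
  proof -
    have "(s y + r *\<^sub>R d y) \<bullet> (s y + r *\<^sub>R d y) = 0"
      by (rule integral_nonneg_eq_0[OF _ _ sq that]) (auto intro!: continuous_intros s d)
    then show ?thesis by (simp add: eq_neg_iff_add_eq_0)
  qed
  have "edge_integral e (\<lambda>y. s y \<bullet> s y) = edge_integral e (\<lambda>y. (- r) * (d y \<bullet> s y))"
    by (rule integral_cong) (metis eq inner_scaleR_left)
  also have "\<dots> = 0" unfolding integral_cmult using orth by simp
  finally have "s x \<bullet> s x = 0"
    by (intro integral_nonneg_eq_0[of "\<lambda>y. s y \<bullet> s y"] x) (auto intro!: continuous_intros s)
  then show "s x = 0" by simp
  with eq[OF x] r show "d x = 0" by simp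
qed

end

subsection \<open>Jumps, averages and traces\<close>

lemma tensor_inner: "tensor v n \<bullet> tensor w n = (v \<bullet> w) * (n \<bullet> n)"
  by (simp add: tensor_def inner_vec_def sum_2 algebra_simps)

lemma tensor_diff: "tensor (v - w) n = tensor v n - tensor w n"
  and tensor_minus: "tensor v (- n) = - tensor v n"
  and tensor_scaleR: "tensor (r *\<^sub>R v) n = r *\<^sub>R tensor v n"
  by (simp_all add: tensor_def vec_eq_iff algebra_simps)

lemma cross_diff: "cross (v - w) n = cross v n - cross w n"
  and cross_scaleR: "cross (r *\<^sub>R v) n = r * cross v n"
  and cross_self: "cross n n = 0"
  by (simp_all add: cross_def algebra_simps)

text \<open>\<open>cross v n\<close> is the coordinate of \<open>v\<close> along the quarter turn of
  \<open>n\<close>, so this is the expansion of the inner product in an orthonormal frame.\<close>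

lemma inner_normal_tangential:
  assumes "norm n = 1"
  shows "v \<bullet> w = (v \<bullet> n) * (w \<bullet> n) + cross v n * cross w n"
proof -
  have "n $ 1 * n $ 1 + n $ 2 * n $ 2 = 1"
    using assms by (simp add: norm_eq_1 inner_vec_def sum_2)
  then have "v $ 1 * w $ 1 + v $ 2 * w $ 2 =
      (v $ 1 * n $ 1 + v $ 2 * n $ 2) * (w $ 1 * n $ 1 + w $ 2 * n $ 2)
      + (v $ 1 * n $ 2 - v $ 2 * n $ 1) * (w $ 1 * n $ 2 - w $ 2 * n $ 1)"
    by algebra
  then show ?thesis by (simp add: cross_def inner_vec_def sum_2)
qed

context polygonal_mesh
begin

lemma edge: "e \<in> edges T \<Longrightarrow> edge e"
  by unfold_locales (use edge_closed_segment in blast)+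

lemma int_edgesD: "e \<in> int_edges \<Omega> T \<Longrightarrow> e \<in> edges T"
  and bd_edgesD: "e \<in> bd_edges \<Omega> T \<Longrightarrow> e \<in> edges T"
  by (auto simp: edges_eq)

lemma finite_int_edges [simp]: "finite (int_edges \<Omega> T)"
  and finite_bd_edges [simp]: "finite (bd_edges \<Omega> T)"
  using finite_edges unfolding edges_eq by auto

lemma norm_bd_normal: "e \<in> bd_edges \<Omega> T \<Longrightarrow> norm (bd_normal T e) = 1"
  unfolding bd_normal_def using triangles_at_bd_edge norm_outer_normal by blast

definition continuous_trace :: "(real^2) trace \<Rightarrow> bool" where
  "continuous_trace w \<longleftrightarrow> (\<forall>K\<in>T. \<forall>e. e edge_of K \<longrightarrow> continuous_on e (w K e))"

text \<open>The constraints of \<open>Qh0\<close> without the polynomial degree, so that they also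
  make sense for the residual \<open>u - uhat\<close>, whose degree is that of
  \<open>Vh\<close>.\<close>

definition mean_free :: "(real^2) trace \<Rightarrow> bool" where
  "mean_free w \<longleftrightarrow>
     (\<forall>e\<in>int_edges \<Omega> T. \<forall>x\<in>e. average T w e x = 0) \<and>
     (\<forall>e\<in>bd_edges \<Omega> T. \<forall>x\<in>e. bd_value T w e x \<bullet> bd_normal T e = 0)"

text \<open>This is \<open>bh\<close> with a trace in the first argument too, so that single-valued
  functions and residuals may be inserted.\<close>

definition jump_form :: "(real^2) trace \<Rightarrow> (real^2) trace \<Rightarrow> real" where
  "jump_form w z =
     (1/2) * ip_edges (int_edges \<Omega> T) (jump T w) (jump T z)
   + ip_edges (bd_edges \<Omega> T) (bd_tangential T w) (bd_tangential T z)"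

lemma bh_eq: "bh \<Omega> T v q = jump_form (trace_of v) q"
  by (simp add: bh_def jump_form_def)

lemma Qh0_eq: "Qh0 \<Omega> T k = {q \<in> Qh T k. mean_free q}"
  by (simp add: Qh0_def mean_free_def)

lemma ip_edges_cong:
  assumes "E \<subseteq> edges T"
    and "\<And>e x. e \<in> E \<Longrightarrow> x \<in> e \<Longrightarrow> g e x \<bullet> h e x = g' e x \<bullet> h' e x"
  shows "ip_edges E g h = ip_edges E g' h'"
  unfolding ip_edges_def ip_edge_eq
  by (intro sum.cong refl edge.integral_cong) (use assms edge in auto)

lemma jump_form_cong:
  assumes "\<And>e x. e \<in> int_edges \<Omega> T \<Longrightarrow> x \<in> e \<Longrightarrow>
      jump T w e x \<bullet> jump T z e x = jump T w' e x \<bullet> jump T z' e x"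
    and "\<And>e x. e \<in> bd_edges \<Omega> T \<Longrightarrow> x \<in> e \<Longrightarrow>
      bd_tangential T w e x * bd_tangential T z e x = bd_tangential T w' e x * bd_tangential T z' e x"
  shows "jump_form w z = jump_form w' z'"
proof -
  have "ip_edges (int_edges \<Omega> T) (jump T w) (jump T z) = ip_edges (int_edges \<Omega> T) (jump T w') (jump T z')"
    by (rule ip_edges_cong) (auto simp: int_edgesD assms)
  moreover have "ip_edges (bd_edges \<Omega> T) (bd_tangential T w) (bd_tangential T z) =
      ip_edges (bd_edges \<Omega> T) (bd_tangential T w') (bd_tangential T z')"
    by (rule ip_edges_cong) (auto simp: bd_edgesD assms)
  ultimately show ?thesis by (simp add: jump_form_def)
qed

section \<open>Boundary pairings as sums over edges\<close>

lemma ip_boundaries_eq: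
  assumes "continuous_trace w" "continuous_trace z"
  shows "ip_boundaries T w z =
    (\<Sum>e\<in>edges T. edge_integral e (\<lambda>x. \<Sum>K\<in>triangles_at T e. w K e x \<bullet> z K e x))"
proof -
  have "ip_boundaries T w z =
      (\<Sum>K\<in>T. \<Sum>e | e \<in> edges T \<and> e edge_of K. ip_edge e (w K e) (z K e))"
    unfolding ip_boundaries_def by (intro sum.cong refl) (auto simp: edges_def)
  also have "\<dots> = (\<Sum>e\<in>edges T. \<Sum>K | K \<in> T \<and> e edge_of K. ip_edge e (w K e) (z K e))"
    by (rule sum.swap_restrict) auto
  also have "\<dots> = (\<Sum>e\<in>edges T. edge_integral e (\<lambda>x. \<Sum>K\<in>triangles_at T e. w K e x \<bullet> z K e x))"
  proof (intro sum.cong refl)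
    fix e assume "e \<in> edges T"
    then interpret edge e by (rule edge)
    show "(\<Sum>K | K \<in> T \<and> e edge_of K. ip_edge e (w K e) (z K e)) =
        edge_integral e (\<lambda>x. \<Sum>K\<in>triangles_at T e. w K e x \<bullet> z K e x)"
      using assms unfolding triangles_at_def[symmetric] ip_edge_eq
      by (intro integral_sum[symmetric] continuous_intros)
        (auto simp: continuous_trace_def triangles_at_def)
  qed
  finally show ?thesis .
qed

lemma ip_boundaries_commute: "ip_boundaries T w z = ip_boundaries T z w"
  by (simp add: ip_boundaries_def ip_edge_eq inner_commute)

lemma ip_boundaries_add_left:
  assumes "continuous_trace w" "continuous_trace w'" "continuous_trace z"
  shows "ip_boundaries T (\<lambda>K e x. w K e x + w' K e x) z = ip_boundaries T w z + ip_boundaries T w' z"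
proof -
  have "ip_edge e (\<lambda>x. w K e x + w' K e x) (z K e) = ip_edge e (w K e) (z K e) + ip_edge e (w' K e) (z K e)"
    if K: "K \<in> T" "e edge_of K" for K e
  proof -
    interpret edge e using K by (intro edge) (auto simp: edges_def)
    show ?thesis
      using assms K unfolding ip_edge_eq inner_add_left
      by (intro integral_add continuous_intros) (auto simp: continuous_trace_def)
  qed
  then show ?thesis by (simp add: ip_boundaries_def sum.distrib)
qed

text \<open>The triangles and the normal are chosen once for all traces \<open>w\<close>, so that
  averages and jumps of different traces can be compared.\<close>

lemma int_edge_values:
  assumes "e \<in> int_edges \<Omega> T"
  obtains K K' n where "triangles_at T e = {K, K'}" "K \<noteq> K'" "norm n = 1"
    and "\<forall>w x. average T w e x = (1/2) *\<^sub>R (w K e x + w K' e x)"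
    and "\<forall>w x. jump T w e x = tensor (w K e x - w K' e x) n"
proof -
  obtain K K' where K: "triangles_at T e = {K, K'}" "K \<noteq> K'"
    and n: "norm (outer_normal K e) = 1" "outer_normal K' e = - outer_normal K e"
    using triangles_at_int_edge[OF assms] .
  show ?thesis
    by (rule that[OF K n(1)]) (use K n in \<open>simp_all add: average_def jump_def tensor_diff tensor_minus\<close>)
qed

text \<open>On an interior edge the two values of \<open>z\<close> are opposite, so the two products
  add up to (w - w') \<bullet> z, which is half of (w - w') \<bullet> (z - z'). This is the origin
  of the factor 1/2. On a boundary edge only the tangential product survives.\<close>

lemma ip_boundaries_mean_free:
  assumes w: "continuous_trace w" and z: "continuous_trace z" "mean_free z"
  shows "ip_boundaries T w z = jump_form w z"
proof -
  let ?s = "\<lambda>e x. \<Sum>K\<in>triangles_at T e. w K e x \<bullet> z K e x"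
  have "ip_boundaries T w z = (\<Sum>e\<in>int_edges \<Omega> T. edge_integral e (?s e)) +
      (\<Sum>e\<in>bd_edges \<Omega> T. edge_integral e (?s e))"
    using ip_boundaries_eq[OF w z(1)] edges_disjoint by (simp add: edges_eq sum.union_disjoint)
  also have "(\<Sum>e\<in>int_edges \<Omega> T. edge_integral e (?s e)) =
      (1/2) * ip_edges (int_edges \<Omega> T) (jump T w) (jump T z)"
    unfolding ip_edges_def ip_edge_eq sum_distrib_left
  proof (rule sum.cong[OF refl])
    fix e assume e: "e \<in> int_edges \<Omega> T"
    then interpret edge e by (intro edge int_edgesD)
    obtain K K' n where K: "triangles_at T e = {K, K'}" "K \<noteq> K'" and n: "norm n = 1"
      and av: "\<forall>w x. average T w e x = (1/2) *\<^sub>R (w K e x + w K' e x)"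
      and jump: "\<forall>w x. jump T w e x = tensor (w K e x - w K' e x) n"
      using int_edge_values[OF e] .
    show "edge_integral e (?s e) = (1/2) * edge_integral e (\<lambda>x. jump T w e x \<bullet> jump T z e x)"
      unfolding integral_cmult[symmetric]
    proof (rule integral_cong)
      fix x assume x: "x \<in> e"
      then have "average T z e x = 0" using z(2) e by (simp add: mean_free_def)
      then have "z K e x + z K' e x = 0" by (simp add: av)
      then have z': "z K' e x = - z K e x" by (simp add: add_eq_0_iff)
      have "jump T w e x \<bullet> jump T z e x = (w K e x - w K' e x) \<bullet> (z K e x - z K' e x)"
        using n by (simp add: jump tensor_inner dot_square_norm)
      also have "\<dots> = 2 * ((w K e x - w K' e x) \<bullet> z K e x)"
        unfolding z' by (simp flip: scaleR_2)
      finally show "?s e x = 1/2 * (jump T w e x \<bullet> jump T z e x)"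
        using K z' by (simp add: inner_diff_left)
    qed
  qed
  also have "(\<Sum>e\<in>bd_edges \<Omega> T. edge_integral e (?s e)) =
      ip_edges (bd_edges \<Omega> T) (bd_tangential T w) (bd_tangential T z)"
    unfolding ip_edges_def ip_edge_eq
  proof (rule sum.cong[OF refl])
    fix e assume e: "e \<in> bd_edges \<Omega> T"
    then interpret edge e by (intro edge bd_edgesD)
    show "edge_integral e (?s e) = edge_integral e (\<lambda>x. bd_tangential T w e x \<bullet> bd_tangential T z e x)"
    proof (rule integral_cong)
      fix x assume x: "x \<in> e"
      have "?s e x = bd_value T w e x \<bullet> bd_value T z e x"
        using triangles_at_bd_edge[OF e] by (simp add: bd_value_def)
      also have "\<dots> = bd_tangential T w e x \<bullet> bd_tangential T z e x"
        using inner_normal_tangential[OF norm_bd_normal[OF e], of "bd_value T w e x" "bd_value T z e x"]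
          z(2) e x
        by (simp add: mean_free_def bd_tangential_def)
      finally show "?s e x = bd_tangential T w e x \<bullet> bd_tangential T z e x" .
    qed
  qed
  finally show ?thesis by (simp add: jump_form_def)
qed

subsection \<open>Finite element functions on edges\<close>

lemma VhD: "v \<in> Vh T k \<Longrightarrow> K \<in> T \<Longrightarrow> e edge_of K \<Longrightarrow> v K \<in> Poly2 (2 * k - 1) e"
  using Poly2_mono[OF order_refl edge_of_imp_subset, of e K "v K" "2 * k - 1"]
  by (simp add: Vh_def Pi_iff)

lemma QhD: "q \<in> Qh T k \<Longrightarrow> K \<in> T \<Longrightarrow> e edge_of K \<Longrightarrow> q K e \<in> Poly2 (k - 1) e"
  by (auto simp: Qh_def Pi_iff)

lemma VhatD: "w \<in> Vhat \<Omega> T k \<Longrightarrow> e \<in> edges T \<Longrightarrow> w e \<in> Poly2 (2 * k - 1) e"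
  by (auto simp: Vhat_def Pi_iff)

lemma continuous_trace_Vh: "v \<in> Vh T k \<Longrightarrow> continuous_trace (trace_of v)"
  by (auto simp: continuous_trace_def trace_of_def intro: Poly2_continuous_on VhD)

lemma continuous_trace_Qh: "q \<in> Qh T k \<Longrightarrow> continuous_trace q"
  by (auto simp: continuous_trace_def intro: Poly2_continuous_on QhD)

lemma continuous_trace_Vhat: "w \<in> Vhat \<Omega> T k \<Longrightarrow> continuous_trace (\<lambda>K. w)"
  by (auto simp: continuous_trace_def edges_def intro!: Poly2_continuous_on[OF VhatD])

text \<open>The weight \<gamma> is an arbitrary number per edge: the penalty gives the stabilising
  part of the flux, the constant 1 gives the second equation.\<close>

lemma continuous_trace_residual:
  assumes "u \<in> Vh T k" "uhat \<in> Vhat \<Omega> T k"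
  shows "continuous_trace (\<lambda>K e x. \<gamma> e *\<^sub>R (u K x - uhat e x))"
  using continuous_trace_Vh[OF assms(1)] continuous_trace_Vhat[OF assms(2)]
  by (auto simp: continuous_trace_def trace_of_def intro!: continuous_intros)

lemma mean_free_residual:
  assumes "skeleton_values_of \<Omega> T k u uhat"
  shows "mean_free (\<lambda>K e x. \<gamma> e *\<^sub>R (u K x - uhat e x))"
  unfolding mean_free_def
proof (intro conjI ballI)
  fix e x assume e: "e \<in> int_edges \<Omega> T" and x: "x \<in> e"
  obtain K K' n where av: "\<And>w x. average T w e x = (1/2) *\<^sub>R (w K e x + w K' e x)"
    using int_edge_values[OF e] by metis
  have "uhat e x = (1/2) *\<^sub>R (u K x + u K' x)"
    using assms e x av by (simp add: skeleton_values_of_def trace_of_def)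
  then have "2 *\<^sub>R uhat e x = u K x + u K' x" by simp
  then have "(u K x - uhat e x) + (u K' x - uhat e x) = 0" by (simp add: scaleR_2 algebra_simps)
  then show "average T (\<lambda>K e x. \<gamma> e *\<^sub>R (u K x - uhat e x)) e x = 0"
    unfolding av scaleR_add_right[symmetric] by simp
next
  fix e x assume "e \<in> bd_edges \<Omega> T" "x \<in> e"
  then show "bd_value T (\<lambda>K e x. \<gamma> e *\<^sub>R (u K x - uhat e x)) e x \<bullet> bd_normal T e = 0"
    using assms by (simp add: skeleton_values_of_def trace_of_def bd_value_def inner_diff_left)
qed

text \<open>\<open>uhat\<close> has the same value from both sides and cancels in the jump.\<close>

lemma jump_residual:
  assumes "e \<in> int_edges \<Omega> T"
  shows "jump T (\<lambda>K e x. \<gamma> e *\<^sub>R (u K x - uhat e x)) e x = \<gamma> e *\<^sub>R jump T (trace_of u) e x"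
proof -
  obtain K K' n where "\<And>w x. jump T w e x = tensor (w K e x - w K' e x) n"
    using int_edge_values[OF assms] by metis
  then show ?thesis
    by (simp add: trace_of_def tensor_scaleR[symmetric] scaleR_diff_right[symmetric])
qed

lemma bd_tangential_residual:
  assumes "uhat \<in> Vhat \<Omega> T k" "e \<in> bd_edges \<Omega> T" "x \<in> e"
  shows "bd_tangential T (\<lambda>K e x. \<gamma> e *\<^sub>R (u K x - uhat e x)) e x = \<gamma> e * bd_tangential T (trace_of u) e x"
  using assms by (simp add: bd_tangential_def bd_value_def trace_of_def cross_scaleR cross_diff Vhat_def)

text \<open>Here the residual is the mean-free partner, so \<open>z\<close> can be any continuous
  trace, in particular a member of \<open>Qh\<close> with nonzero averages.\<close>

lemma ip_boundaries_residual:
  assumes u: "u \<in> Vh T k" and skel: "skeleton_values_of \<Omega> T k u uhat" and z: "continuous_trace z"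
  shows "ip_boundaries T (\<lambda>K e x. \<gamma> e *\<^sub>R (u K x - uhat e x)) z =
     (1/2) * ip_edges (int_edges \<Omega> T) (\<lambda>e x. \<gamma> e *\<^sub>R jump T (trace_of u) e x) (jump T z)
   + ip_edges (bd_edges \<Omega> T) (\<lambda>e x. \<gamma> e * bd_tangential T (trace_of u) e x) (bd_tangential T z)"
proof -
  let ?r = "\<lambda>K e x. \<gamma> e *\<^sub>R (u K x - uhat e x)"
  have uhat: "uhat \<in> Vhat \<Omega> T k" using skel by (simp add: skeleton_values_of_def)
  have "ip_boundaries T ?r z = jump_form z ?r"
    using ip_boundaries_mean_free[OF z continuous_trace_residual[OF u uhat] mean_free_residual[OF skel]]
    by (simp add: ip_boundaries_commute[of _ z])
  moreover have "ip_edges (int_edges \<Omega> T) (jump T z) (jump T ?r) =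
      ip_edges (int_edges \<Omega> T) (\<lambda>e x. \<gamma> e *\<^sub>R jump T (trace_of u) e x) (jump T z)"
    by (rule ip_edges_cong) (simp_all add: subsetI int_edgesD jump_residual inner_commute)
  moreover have "ip_edges (bd_edges \<Omega> T) (bd_tangential T z) (bd_tangential T ?r) =
      ip_edges (bd_edges \<Omega> T) (\<lambda>e x. \<gamma> e * bd_tangential T (trace_of u) e x) (bd_tangential T z)"
    by (rule ip_edges_cong) (simp_all add: subsetI bd_edgesD bd_tangential_residual[OF uhat] mult.commute)
  ultimately show ?thesis by (simp add: jump_form_def)
qed

lemma ip_boundaries_residual_bh:
  assumes "u \<in> Vh T k" "skeleton_values_of \<Omega> T k u uhat" "q \<in> Qh T k"
  shows "ip_boundaries T (\<lambda>K e x. u K x - uhat e x) q = bh \<Omega> T u q"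
  using ip_boundaries_residual[OF assms(1,2) continuous_trace_Qh[OF assms(3)], of "\<lambda>_. 1"]
  by (simp add: bh_def)

text \<open>The flux is the sum of two mean-free traces: \<open>p\<close> contributes
  \<open>bh\<close> and the weighted residual contributes the penalty terms of
  \<open>ah\<close>.\<close>

lemma flux_form_eq:
  assumes u: "u \<in> Vh T k" and p: "p \<in> Qh0 \<Omega> T k" and skel: "skeleton_values_of \<Omega> T k u uhat"
    and v: "v \<in> Vh T k"
  shows "vol_form T \<alpha> u v + ip_boundaries T (numerical_flux \<Omega> \<mu> u p uhat) (trace_of v) =
    ah \<Omega> T \<mu> \<alpha> u v + bh \<Omega> T v p"
proof -
  have uhat: "uhat \<in> Vhat \<Omega> T k" using skel by (simp add: skeleton_values_of_def)
  have p': "continuous_trace p" "mean_free p" using p continuous_trace_Qh by (auto simp: Qh0_eq)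
  note cv = continuous_trace_Vh[OF v]
  have "ip_boundaries T (numerical_flux \<Omega> \<mu> u p uhat) (trace_of v) =
      ip_boundaries T p (trace_of v)
      + ip_boundaries T (\<lambda>K e x. penalty \<Omega> \<mu> e *\<^sub>R (u K x - uhat e x)) (trace_of v)"
    unfolding numerical_flux_def[abs_def]
    by (rule ip_boundaries_add_left[OF p'(1) continuous_trace_residual[OF u uhat] cv])
  moreover have "ip_boundaries T p (trace_of v) = bh \<Omega> T v p"
    using ip_boundaries_mean_free[OF cv p'] by (simp add: ip_boundaries_commute[of p] bh_eq)
  ultimately show ?thesis
    using ip_boundaries_residual[OF u skel cv] by (simp add: ah_def)
qed

lemma flux_continuity:
  assumes u: "u \<in> Vh T k" and p: "p \<in> Qh0 \<Omega> T k" and skel: "skeleton_values_of \<Omega> T k u uhat"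
    and vhat: "vhat \<in> Vhat \<Omega> T k"
  shows "ip_boundaries T (numerical_flux \<Omega> \<mu> u p uhat) (\<lambda>K. vhat) = 0"
proof -
  let ?v = "\<lambda>K. vhat"
  let ?r = "\<lambda>K e x. penalty \<Omega> \<mu> e *\<^sub>R (u K x - uhat e x)"
  have uhat: "uhat \<in> Vhat \<Omega> T k" using skel by (simp add: skeleton_values_of_def)
  have p': "continuous_trace p" "mean_free p" using p continuous_trace_Qh by (auto simp: Qh0_eq)
  note cv = continuous_trace_Vhat[OF vhat] and cr = continuous_trace_residual[OF u uhat]
  have zero: "ip_boundaries T w ?v = 0" if w: "continuous_trace w" "mean_free w" for w
  proof -
    have "ip_boundaries T w ?v = jump_form ?v w"
      using ip_boundaries_mean_free[OF cv w] by (simp add: ip_boundaries_commute)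
    \<comment> \<open>A single-valued function with no tangential part on the boundary has the jump
      data of the zero trace, whose boundary pairing is plainly zero.\<close>
    also have "\<dots> = jump_form (\<lambda>K e x. 0) w"
    proof (rule jump_form_cong)
      fix e x assume "e \<in> int_edges \<Omega> T"
      then obtain K K' n where "\<And>w x. jump T w e x = tensor (w K e x - w K' e x) n"
        using int_edge_values by metis
      then show "jump T ?v e x \<bullet> jump T w e x = jump T (\<lambda>K e x. 0) e x \<bullet> jump T w e x" by simp
    next
      fix e x assume "e \<in> bd_edges \<Omega> T" "x \<in> e"
      then have "bd_tangential T ?v e x = 0" "bd_tangential T (\<lambda>K e x. 0) e x = 0"
        using vhat by (auto simp: bd_tangential_def bd_value_def Vhat_def cross_def)
      then show "bd_tangential T ?v e x * bd_tangential T w e x =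
          bd_tangential T (\<lambda>K e x. 0) e x * bd_tangential T w e x" by simp
    qed
    also have "\<dots> = ip_boundaries T (\<lambda>K e x. 0) w"
      by (rule ip_boundaries_mean_free[symmetric, OF _ w]) (simp add: continuous_trace_def)
    also have "\<dots> = 0" by (simp add: ip_boundaries_def ip_edge_def case_prod_beta)
    finally show ?thesis .
  qed
  have "ip_boundaries T (numerical_flux \<Omega> \<mu> u p uhat) ?v = ip_boundaries T p ?v + ip_boundaries T ?r ?v"
    unfolding numerical_flux_def[abs_def] by (rule ip_boundaries_add_left[OF p'(1) cr cv])
  then show ?thesis using zero[OF p'] zero[OF cr mean_free_residual[OF skel]] by simp
qed

text \<open>Subtracting the average (the normal component on the boundary) leaves jumps unchanged.\<close>

lemma bh_mean_free_part:
  assumes q: "q \<in> Qh T k"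
  obtains q' where "q' \<in> Qh0 \<Omega> T k" "bh \<Omega> T u q = bh \<Omega> T u q'"
proof -
  define m where "m e x = (if e \<in> int_edges \<Omega> T then average T q e x
      else (bd_value T q e x \<bullet> bd_normal T e) *\<^sub>R bd_normal T e)" for e x
  define q' where "q' = (\<lambda>K e x. q K e x - m e x)"
  have m_poly: "m e \<in> Poly2 (k - 1) e" if e: "e \<in> edges T" for e
  proof (cases "e \<in> int_edges \<Omega> T")
    case True
    then show ?thesis
      unfolding m_def[abs_def] average_def
      using triangles_atD
      by (simp only: if_True) (intro Poly2_scaleR Poly2_sum QhD[OF q]; blast)
  next
    case False
    then have "bd_triangle T e \<in> triangles_at T e"
      using e triangles_at_bd_edge by (auto simp: edges_eq)
    then have "q (bd_triangle T e) e \<in> Poly2 (k - 1) e"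
      using q triangles_atD QhD by blast
    with False show ?thesis
      unfolding m_def[abs_def] bd_value_def by (auto intro!: Poly2_inner_scaleR)
  qed
  have "q' \<in> Qh T k"
    unfolding q'_def Qh_def
    by (intro Pi_I Poly2_diff QhD[OF q] m_poly) (auto simp: edges_def)
  moreover have "mean_free q'"
    unfolding mean_free_def
  proof (intro conjI ballI)
    fix e x assume e: "e \<in> int_edges \<Omega> T"
    obtain K K' n where av: "\<And>w x. average T w e x = (1/2) *\<^sub>R (w K e x + w K' e x)"
      using int_edge_values[OF e] by metis
    have "2 *\<^sub>R m e x = q K e x + q K' e x" using e by (simp add: m_def av)
    then have "q' K e x + q' K' e x = 0" by (simp add: q'_def scaleR_2 algebra_simps)
    then show "average T q' e x = 0" by (simp add: av)
  next
    fix e x assume e: "e \<in> bd_edges \<Omega> T"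
    then have "e \<notin> int_edges \<Omega> T" using edges_disjoint by blast
    then show "bd_value T q' e x \<bullet> bd_normal T e = 0"
      using norm_bd_normal[OF e] by (simp add: q'_def m_def bd_value_def inner_diff_left dot_square_norm)
  qed
  moreover have "bh \<Omega> T u q = bh \<Omega> T u q'"
    unfolding bh_eq
  proof (rule jump_form_cong)
    fix e x assume e: "e \<in> int_edges \<Omega> T"
    obtain K K' n where "\<And>w x. jump T w e x = tensor (w K e x - w K' e x) n"
      using int_edge_values[OF e] by metis
    then have "jump T q' e x = jump T q e x" by (simp add: q'_def)
    then show "jump T (trace_of u) e x \<bullet> jump T q e x = jump T (trace_of u) e x \<bullet> jump T q' e x"
      by simp
  next
    fix e x assume e: "e \<in> bd_edges \<Omega> T"
    then have "e \<notin> int_edges \<Omega> T" using edges_disjoint by blast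
    then have "bd_tangential T q' e x = bd_tangential T q e x"
      by (simp add: bd_tangential_def q'_def m_def bd_value_def cross_diff cross_scaleR cross_self)
    then show "bd_tangential T (trace_of u) e x * bd_tangential T q e x =
        bd_tangential T (trace_of u) e x * bd_tangential T q' e x" by simp
  qed
  ultimately show ?thesis using that by (auto simp: Qh0_eq)
qed

text \<open>The test function takes the same value \<open>g\<close> from every side, so only the sum
  of the one-sided values of \<open>w\<close> is seen. It can be read as an element of
  \<open>Qh\<close> or as a single-valued skeleton function.\<close>

lemma ip_boundaries_single_edge:
  assumes e: "e \<in> edges T" and w: "continuous_trace w" and g: "continuous_on e g"
  shows "ip_boundaries T w (\<lambda>K e'. if e' = e then g else (\<lambda>_. 0)) =
    edge_integral e (\<lambda>x. (\<Sum>K\<in>triangles_at T e. w K e x) \<bullet> g x)"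
proof -
  have "edge_integral e' (\<lambda>x. \<Sum>K\<in>triangles_at T e'. w K e' x \<bullet> (if e' = e then g else (\<lambda>_. 0)) x) =
      (if e' = e then edge_integral e (\<lambda>x. (\<Sum>K\<in>triangles_at T e. w K e x) \<bullet> g x) else 0)" for e'
    by (simp add: inner_sum_left edge_integral_def ip_edge_def case_prod_beta)
  moreover have "continuous_trace (\<lambda>K e'. if e' = e then g else (\<lambda>_. 0))"
    using g by (auto simp: continuous_trace_def)
  ultimately show ?thesis using e w by (simp add: ip_boundaries_eq)
qed

subsection \<open>The multiplier and the skeleton values are determined edge by edge\<close>

text \<open>The second and third equations of the three-field problem alone already force
  \<open>p\<close> to be mean-free and \<open>uhat\<close> to have the prescribed skeleton
  values.\<close>

context
  fixes k \<mu> u p uhat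
  assumes u: "u \<in> Vh T k" and p: "p \<in> Qh T k" and uhat: "uhat \<in> Vhat \<Omega> T k"
    and eq2: "\<And>q. q \<in> Qh T k \<Longrightarrow> ip_boundaries T (\<lambda>K e x. u K x - uhat e x) q = 0"
    and eq3: "\<And>v. v \<in> Vhat \<Omega> T k \<Longrightarrow>
      ip_boundaries T (numerical_flux \<Omega> \<mu> u p uhat) (\<lambda>K. v) = 0"
begin

lemma residual_poly:
  assumes "K \<in> triangles_at T e"
  shows "(\<lambda>x. u K x - uhat e x) \<in> Poly2 (2 * k - 1) e"
  using triangles_atD[OF assms] by (intro Poly2_diff VhD[OF u] VhatD[OF uhat]) blast+

lemma multiplier_poly:
  assumes "K \<in> triangles_at T e"
  shows "p K e \<in> Poly2 (k - 1) e"
  using triangles_atD[OF assms] QhD[OF p] by blast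

lemma flux_poly:
  assumes "K \<in> triangles_at T e"
  shows "numerical_flux \<Omega> \<mu> u p uhat K e \<in> Poly2 (2 * k - 1) e"
  unfolding numerical_flux_def[abs_def]
  by (intro Poly2_add Poly2_scaleR residual_poly[OF assms]
      Poly2_mono[OF _ order_refl multiplier_poly[OF assms]]) simp

lemma residual_orthogonal:
  assumes e: "e \<in> edges T" and g: "g \<in> Poly2 (k - 1) e"
  shows "edge_integral e (\<lambda>x. (\<Sum>K\<in>triangles_at T e. u K x - uhat e x) \<bullet> g x) = 0"
proof -
  have "(\<lambda>K e'. if e' = e then g else (\<lambda>_. 0)) \<in> Qh T k"
    using g by (auto simp: Qh_def Poly2_zero)
  then show ?thesis
    using eq2 ip_boundaries_single_edge[OF e continuous_trace_residual[OF u uhat, of "\<lambda>_. 1"]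
        Poly2_continuous_on[OF g]] by simp
qed

lemma flux_orthogonal:
  assumes e: "e \<in> edges T" and g: "g \<in> Poly2 (2 * k - 1) e"
    and bd: "\<And>x. e \<in> bd_edges \<Omega> T \<Longrightarrow> cross (g x) (bd_normal T e) = 0"
  shows "edge_integral e (\<lambda>x. (\<Sum>K\<in>triangles_at T e. numerical_flux \<Omega> \<mu> u p uhat K e x) \<bullet> g x) = 0"
proof -
  have v: "(\<lambda>e'. if e' = e then g else (\<lambda>_. 0)) \<in> Vhat \<Omega> T k"
    using g bd by (auto simp: Vhat_def Poly2_zero cross_def[of 0])
  have flux: "continuous_trace (numerical_flux \<Omega> \<mu> u p uhat)"
    unfolding continuous_trace_def
    by (auto intro!: Poly2_continuous_on flux_poly simp: triangles_at_def)
  show ?thesis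
    using eq3[OF v] ip_boundaries_single_edge[OF e flux Poly2_continuous_on[OF g]] by (rule trans[OF sym, rotated])
qed

lemma int_edge_solution:
  assumes e: "e \<in> int_edges \<Omega> T" and x: "x \<in> e"
  shows "average T p e x = 0" "uhat e x = average T (trace_of u) e x"
proof -
  have eT: "e \<in> edges T" using e by (rule int_edgesD)
  interpret edge e using eT by (rule edge)
  \<comment> \<open>Sums in place of averages: \<open>s\<close> is twice {p}, and \<open>d\<close>
    is twice {u} - uhat.\<close>
  define s where "s = (\<lambda>x. \<Sum>K\<in>triangles_at T e. p K e x)"
  define d where "d = (\<lambda>x. \<Sum>K\<in>triangles_at T e. u K x - uhat e x)"
  have flux: "(\<Sum>K\<in>triangles_at T e. numerical_flux \<Omega> \<mu> u p uhat K e x) =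
      s x + penalty \<Omega> \<mu> e *\<^sub>R d x" for x
    by (simp add: numerical_flux_def s_def d_def sum.distrib scaleR_sum_right)
  have s: "s \<in> Poly2 (k - 1) e" unfolding s_def by (intro Poly2_sum multiplier_poly)
  have d: "d \<in> Poly2 (2 * k - 1) e" unfolding d_def by (intro Poly2_sum residual_poly)
  have "s \<in> Poly2 (2 * k - 1) e" by (rule Poly2_mono[OF _ order_refl s]) simp
  then have sd: "(\<lambda>x. s x + penalty \<Omega> \<mu> e *\<^sub>R d x) \<in> Poly2 (2 * k - 1) e"
    by (intro Poly2_add Poly2_scaleR d)
  have "edge_integral e (\<lambda>x. (s x + penalty \<Omega> \<mu> e *\<^sub>R d x) \<bullet> (s x + penalty \<Omega> \<mu> e *\<^sub>R d x)) = 0"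
    using flux_orthogonal[OF eT sd] e edges_disjoint by (auto simp: flux)
  moreover have "edge_integral e (\<lambda>x. d x \<bullet> s x) = 0"
    using residual_orthogonal[OF eT s] by (simp add: d_def)
  ultimately have zero: "s x = 0" "d x = 0"
    using flux_components_vanish[OF Poly2_continuous_on[OF s] Poly2_continuous_on[OF d]
        penalty_nonzero[OF eT] _ _ x] by auto
  obtain K K' where K: "triangles_at T e = {K, K'}" "K \<noteq> K'" using int_edge_values[OF e] by metis
  show "average T p e x = 0" using zero(1) by (simp add: average_def s_def)
  have "u K x + u K' x = 2 *\<^sub>R uhat e x"
    using zero(2) K by (simp add: d_def scaleR_2 algebra_simps)
  then show "uhat e x = average T (trace_of u) e x"
    using K by (simp add: average_def trace_of_def)
qed

lemma bd_edge_solution: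
  assumes e: "e \<in> bd_edges \<Omega> T" and x: "x \<in> e"
  shows "bd_value T p e x \<bullet> bd_normal T e = 0"
    "uhat e x \<bullet> bd_normal T e = bd_value T (trace_of u) e x \<bullet> bd_normal T e"
proof -
  have eT: "e \<in> edges T" using e by (rule bd_edgesD)
  interpret edge e using eT by (rule edge)
  define K n where "K = bd_triangle T e" and "n = bd_normal T e"
  have K: "triangles_at T e = {K}" using triangles_at_bd_edge[OF e] by (simp add: K_def)
  then have Ke: "K \<in> triangles_at T e" by simp
  define s where "s = (\<lambda>x. p K e x \<bullet> n)"
  define d where "d = (\<lambda>x. (u K x - uhat e x) \<bullet> n)"
  have flux: "numerical_flux \<Omega> \<mu> u p uhat K e x \<bullet> n = s x + penalty \<Omega> \<mu> e *\<^sub>R d x" for x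
    by (simp add: numerical_flux_def s_def d_def inner_add_left)
  \<comment> \<open>The full flux is not admissible in \<open>Vhat\<close> on a boundary edge; its
    normal part is, and pairing the flux with it gives the square of the normal component.\<close>
  have "edge_integral e (\<lambda>x. numerical_flux \<Omega> \<mu> u p uhat K e x \<bullet>
      (numerical_flux \<Omega> \<mu> u p uhat K e x \<bullet> n) *\<^sub>R n) = 0"
    using flux_orthogonal[OF eT Poly2_inner_scaleR[OF flux_poly[OF Ke], of n n]] K
    by (simp add: n_def[symmetric] cross_scaleR cross_self)
  then have sq: "edge_integral e (\<lambda>x. (s x + penalty \<Omega> \<mu> e *\<^sub>R d x) \<bullet> (s x + penalty \<Omega> \<mu> e *\<^sub>R d x)) = 0"
    by (simp only: inner_scaleR_right flux inner_real_def)
  have orth: "edge_integral e (\<lambda>x. d x \<bullet> s x) = 0"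
    using residual_orthogonal[OF eT Poly2_inner_scaleR[OF multiplier_poly[OF Ke], of n n]] K
    by (simp add: s_def d_def mult.commute)
  have "continuous_on e s" "continuous_on e d"
    unfolding s_def d_def
    by (intro continuous_intros Poly2_continuous_on[OF multiplier_poly[OF Ke]]
        Poly2_continuous_on[OF residual_poly[OF Ke]])+
  then have "s x = 0" "d x = 0"
    using flux_components_vanish[OF _ _ penalty_nonzero[OF eT] sq orth x] by auto
  then show "bd_value T p e x \<bullet> bd_normal T e = 0"
    "uhat e x \<bullet> bd_normal T e = bd_value T (trace_of u) e x \<bullet> bd_normal T e"
    by (simp_all add: s_def d_def bd_value_def trace_of_def K_def n_def inner_diff_left)
qed

lemma multiplier_mean_free: "p \<in> Qh0 \<Omega> T k"
  using p int_edge_solution bd_edge_solution by (simp add: Qh0_def)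

lemma skeleton_values: "skeleton_values_of \<Omega> T k u uhat"
  using uhat int_edge_solution bd_edge_solution by (simp add: skeleton_values_of_def)

end

section \<open>Equivalence of the discrete problems\<close>

lemma three_field_iff_two_field:
  "three_field_solution \<Omega> T k \<mu> \<alpha> f u p uhat \<longleftrightarrow>
    two_field_solution \<Omega> T k \<mu> \<alpha> f u p \<and> skeleton_values_of \<Omega> T k u uhat"
proof
  assume 3: "three_field_solution \<Omega> T k \<mu> \<alpha> f u p uhat"
  then have sp: "u \<in> Vh T k" "p \<in> Qh T k" "uhat \<in> Vhat \<Omega> T k"
    and eq1: "\<And>v. v \<in> Vh T k \<Longrightarrow>
      vol_form T \<alpha> u v + ip_boundaries T (numerical_flux \<Omega> \<mu> u p uhat) (trace_of v) = load T f v"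
    and eq2: "\<And>q. q \<in> Qh T k \<Longrightarrow> ip_boundaries T (\<lambda>K e x. u K x - uhat e x) q = 0"
    and eq3: "\<And>v. v \<in> Vhat \<Omega> T k \<Longrightarrow>
      ip_boundaries T (numerical_flux \<Omega> \<mu> u p uhat) (\<lambda>K. v) = 0"
    unfolding three_field_solution_def by blast+
  have p: "p \<in> Qh0 \<Omega> T k" using multiplier_mean_free[OF sp eq2 eq3] .
  have skel: "skeleton_values_of \<Omega> T k u uhat" using skeleton_values[OF sp eq2 eq3] .
  have "ah \<Omega> T \<mu> \<alpha> u v + bh \<Omega> T v p = load T f v" if "v \<in> Vh T k" for v
    using eq1[OF that] flux_form_eq[OF sp(1) p skel that] by simp
  moreover have "bh \<Omega> T u q = 0" if "q \<in> Qh0 \<Omega> T k" for q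
    using that eq2 ip_boundaries_residual_bh[OF sp(1) skel] by (simp add: Qh0_eq)
  ultimately show "two_field_solution \<Omega> T k \<mu> \<alpha> f u p \<and> skeleton_values_of \<Omega> T k u uhat"
    using sp p skel by (simp add: two_field_solution_def)
next
  assume "two_field_solution \<Omega> T k \<mu> \<alpha> f u p \<and> skeleton_values_of \<Omega> T k u uhat"
  then have u: "u \<in> Vh T k" and p: "p \<in> Qh0 \<Omega> T k" and skel: "skeleton_values_of \<Omega> T k u uhat"
    and eq1: "\<And>v. v \<in> Vh T k \<Longrightarrow> ah \<Omega> T \<mu> \<alpha> u v + bh \<Omega> T v p = load T f v"
    and eq2: "\<And>q. q \<in> Qh0 \<Omega> T k \<Longrightarrow> bh \<Omega> T u q = 0"
    unfolding two_field_solution_def by blast+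
  \<comment> \<open>The three-field problem tests with all of \<open>Qh\<close>, the two-field
    problem only with mean-free traces; \<open>q\<close> is replaced by its mean-free part, which
    leaves \<open>bh\<close> unchanged.\<close>
  have "ip_boundaries T (\<lambda>K e x. u K x - uhat e x) q = 0" if q: "q \<in> Qh T k" for q
    using bh_mean_free_part[OF q, of u] eq2 ip_boundaries_residual_bh[OF u skel q] by metis
  moreover have "p \<in> Qh T k" "uhat \<in> Vhat \<Omega> T k"
    using p skel by (auto simp: Qh0_eq skeleton_values_of_def)
  ultimately show "three_field_solution \<Omega> T k \<mu> \<alpha> f u p uhat"
    using u eq1 flux_form_eq[OF u p skel] flux_continuity[OF u p skel]
    by (simp add: three_field_solution_def)
qed

end

text \<open>The constraint on \<open>u\<close> is exactly membership in \<open>Vh0\<close>, and for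
  a test function in \<open>Vh0\<close> the term with \<open>p\<close> vanishes because
  \<open>p\<close> lies in \<open>Qh0\<close>.\<close>

lemma two_field_iff_one_field:
  "two_field_solution \<Omega> T k \<mu> \<alpha> f u p \<longleftrightarrow>
    one_field_solution \<Omega> T k \<mu> \<alpha> f u \<and> multiplier_for \<Omega> T k \<mu> \<alpha> f u p"
proof
  assume 2: "two_field_solution \<Omega> T k \<mu> \<alpha> f u p"
  then have sol: "u \<in> Vh T k" "p \<in> Qh0 \<Omega> T k"
    "\<And>v. v \<in> Vh T k \<Longrightarrow> ah \<Omega> T \<mu> \<alpha> u v + bh \<Omega> T v p = load T f v"
    "\<And>q. q \<in> Qh0 \<Omega> T k \<Longrightarrow> bh \<Omega> T u q = 0"
    unfolding two_field_solution_def by blast+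
  have "ah \<Omega> T \<mu> \<alpha> u v = load T f v" if "v \<in> Vh0 \<Omega> T k" for v
    using that sol(2) sol(3)[of v] by (simp add: Vh0_def)
  then show "one_field_solution \<Omega> T k \<mu> \<alpha> f u \<and> multiplier_for \<Omega> T k \<mu> \<alpha> f u p"
    using sol by (simp add: one_field_solution_def multiplier_for_def Vh0_def)
qed (simp add: two_field_solution_def one_field_solution_def multiplier_for_def Vh0_def)

theorem lemma2p5:
  fixes \<Omega> :: "(real^2) set" and T :: "(real^2) set set" and k :: nat
    and \<mu> :: "real^2 \<Rightarrow> real" and \<alpha> :: real and f :: "real^2 \<Rightarrow> real^2"
    and u :: broken_field and p :: "(real^2) trace" and uhat :: skeleton_field
  assumes "bounded \<Omega>" and "polygonal_domain \<Omega>"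
    and "L2_on \<Omega> f"
    and "conforming_triangulation \<Omega> T"
    and "k \<ge> 1"
    and "grading \<Omega> \<mu>"
  shows "(three_field_solution \<Omega> T k \<mu> \<alpha> f u p uhat \<longleftrightarrow>
            two_field_solution \<Omega> T k \<mu> \<alpha> f u p \<and> skeleton_values_of \<Omega> T k u uhat)
       \<and> (two_field_solution \<Omega> T k \<mu> \<alpha> f u p \<and> skeleton_values_of \<Omega> T k u uhat \<longleftrightarrow>
            one_field_solution \<Omega> T k \<mu> \<alpha> f u \<and> multiplier_for \<Omega> T k \<mu> \<alpha> f u p
              \<and> skeleton_values_of \<Omega> T k u uhat)"
proof -
  interpret polygonal_mesh \<Omega> T using assms by unfold_locales
  show ?thesis using three_field_iff_two_field two_field_iff_one_field by blast
qed

end
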